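(* Let $n\in\{0,1,2\}$, $\gamma>1$, $\gamma_*=\frac{n+3}{n+1}$, and let $S(s)=A_0e^{qs}$ with constants $A_0>0$, $q\neq0$. Consider the Lagrangian $$L=\tfrac12\varphi_t^2-\frac{S(s)}{\gamma-1}\varphi^{n(1-\gamma)}\varphi_s^{1-\gamma}$$ and its Euler–Lagrange equation $(\ast)$ for $\varphi(t,s)$. In addition to the Noether symmetries valid for arbitrary entropy (listed in the context), $$Z_2=2qt\,\partial_t+((n+1)\gamma-n-3)\,\partial_s+q\varphi\,\partial_\varphi$$ is a variational symmetry of $L$, and it gives the conservation law $D_tT_2^t+D_sT_2^s=0$ on solutions of $(\ast)$ with $$T_2^t=-2qt\Big(\frac{\varphi_t^2}{2}+\frac{S}{\gamma-1}\varphi^{n(1-\gamma)}\varphi_s^{1-\gamma}\Big)-((n+1)\gamma-n-3)\varphi_s\varphi_t+q\varphi\varphi_t,$$ $$T_2^s=-2qtS\varphi^{n(1-\gamma)}\varphi_t\varphi_s^{-\gamma}+((n+1)\gamma-n-3)\Big(\frac{\varphi_t^2}{2}-\frac{\gamma S}{\gamma-1}\varphi^{n(1-\gamma)}\varphi_s^{1-\gamma}\Big)+qS\varphi^{-n\gamma+n+1}\varphi_s^{-\gamma}.$$ The Noether symmetries among the point symmetries of $(\ast)$ are spanned by $Z_2$ and those valid for arbitrary entropy for the given $n,\gamma$; when $\gamma=\gamma_*$, $Z_2=q(2t\partial_t+\varphi\partial_\varphi)$, so it is not new.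
   Context: Equation $(\ast)$ is explicitly $\varphi_{tt}+\varphi^{n(1-\gamma)}\varphi_s^{-\gamma}\big(S'-n\gamma S\frac{\varphi_s}{\varphi}-\gamma S\frac{\varphi_{ss}}{\varphi_s}\big)=0$, with $\varphi_s>0$ and $\varphi>0$ when $n\ge1$; it describes one-dimensional flows of a polytropic gas in mass Lagrangian coordinates. $D_t,D_s$ are total derivatives. A point vector field $X=\xi^t\partial_t+\xi^s\partial_s+\eta^\varphi\partial_\varphi$ with coefficients depending on $(t,s,\varphi)$, prolonged to first derivatives, is a Noether symmetry of $L$ if $XL+L(D_t\xi^t+D_s\xi^s)=D_tB_1+D_sB_2$ for some functions $B_1,B_2$ of $(t,s,\varphi)$; it is variational if $B_1=B_2=0$ can be taken. The Noether symmetries valid for arbitrary entropy $S(s)$ are: $\partial_t$ for all $n,\gamma$; additionally $\partial_\varphi$ and $t\partial_\varphi$ if $n=0$; additionally $2t\partial_t+\varphi\partial_\varphi$ and $t^2\partial_t+t\varphi\partial_\varphi$ if $\gamma=\gamma_*$. *)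

theory Defs
  imports "HOL-Analysis.Analysis"
begin

primrec Ck_on :: "nat \<Rightarrow> 'a::euclidean_space set \<Rightarrow> ('a \<Rightarrow> real) \<Rightarrow> bool" where
  "Ck_on 0 U f \<longleftrightarrow> continuous_on U f"
| "Ck_on (Suc k) U f \<longleftrightarrow> f differentiable_on U \<and>
     (\<forall>b\<in>Basis. Ck_on k U (\<lambda>x. frechet_derivative f (at x) b))"

(* C-infinity; intended for open U only, since the derivatives are taken in the full space. *)
definition Cinf_on :: "'a::euclidean_space set \<Rightarrow> ('a \<Rightarrow> real) \<Rightarrow> bool" where
  "Cinf_on U f \<longleftrightarrow> (\<forall>k. Ck_on k U f)"

(* A point of the second-order jet space of maps phi(t,s) is the tuple of its eight coordinates. *)
datatype coord = VT | VS | VPhi | VPhi_t | VPhi_s | VPhi_tt | VPhi_ts | VPhi_ss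

type_synonym jet = "coord \<Rightarrow> real"

definition pd :: "coord \<Rightarrow> (jet \<Rightarrow> real) \<Rightarrow> jet \<Rightarrow> real" where
  "pd c F j = deriv (\<lambda>x. F (j(c := x))) (j c)"

(* The total derivatives, for functions F of order at most one (they are applied to no others). *)
definition Dt :: "(jet \<Rightarrow> real) \<Rightarrow> jet \<Rightarrow> real" where
  "Dt F j = pd VT F j + j VPhi_t * pd VPhi F j
     + j VPhi_tt * pd VPhi_t F j + j VPhi_ts * pd VPhi_s F j"

definition Ds :: "(jet \<Rightarrow> real) \<Rightarrow> jet \<Rightarrow> real" where
  "Ds F j = pd VS F j + j VPhi_s * pd VPhi F j
     + j VPhi_ts * pd VPhi_t F j + j VPhi_ss * pd VPhi_s F j"

definition euler_lagrange :: "(jet \<Rightarrow> real) \<Rightarrow> jet \<Rightarrow> real" where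
  "euler_lagrange L j = pd VPhi L j - Dt (pd VPhi_t L) j - Ds (pd VPhi_s L) j"

type_synonym point = "real \<times> real \<times> real"

definition base :: "jet \<Rightarrow> point" where
  "base j = (j VT, j VS, j VPhi)"

definition lift :: "(point \<Rightarrow> real) \<Rightarrow> jet \<Rightarrow> real" where
  "lift f j = f (base j)"

(* X (t, s, phi) is the triple of coefficients (xi^t, xi^s, eta^phi). *)
type_synonym vfield = "point \<Rightarrow> real \<times> real \<times> real"

definition xi_t :: "vfield \<Rightarrow> point \<Rightarrow> real" where "xi_t X p = fst (X p)"
definition xi_s :: "vfield \<Rightarrow> point \<Rightarrow> real" where "xi_s X p = fst (snd (X p))"
definition eta :: "vfield \<Rightarrow> point \<Rightarrow> real" where "eta X p = snd (snd (X p))"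

definition Cinf_vfield_on :: "point set \<Rightarrow> vfield \<Rightarrow> bool" where
  "Cinf_vfield_on \<Omega> X \<longleftrightarrow> Cinf_on \<Omega> (xi_t X) \<and> Cinf_on \<Omega> (xi_s X) \<and> Cinf_on \<Omega> (eta X)"

definition eta_t :: "vfield \<Rightarrow> jet \<Rightarrow> real" where
  "eta_t X j = Dt (lift (eta X)) j
     - j VPhi_t * Dt (lift (xi_t X)) j - j VPhi_s * Dt (lift (xi_s X)) j"

definition eta_s :: "vfield \<Rightarrow> jet \<Rightarrow> real" where
  "eta_s X j = Ds (lift (eta X)) j
     - j VPhi_t * Ds (lift (xi_t X)) j - j VPhi_s * Ds (lift (xi_s X)) j"

definition eta_tt :: "vfield \<Rightarrow> jet \<Rightarrow> real" where
  "eta_tt X j = Dt (eta_t X) j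
     - j VPhi_tt * Dt (lift (xi_t X)) j - j VPhi_ts * Dt (lift (xi_s X)) j"

definition eta_ts :: "vfield \<Rightarrow> jet \<Rightarrow> real" where
  "eta_ts X j = Ds (eta_t X) j
     - j VPhi_tt * Ds (lift (xi_t X)) j - j VPhi_ts * Ds (lift (xi_s X)) j"

definition eta_ss :: "vfield \<Rightarrow> jet \<Rightarrow> real" where
  "eta_ss X j = Ds (eta_s X) j
     - j VPhi_ts * Ds (lift (xi_t X)) j - j VPhi_ss * Ds (lift (xi_s X)) j"

definition pr1 :: "vfield \<Rightarrow> (jet \<Rightarrow> real) \<Rightarrow> jet \<Rightarrow> real" where
  "pr1 X F j = lift (xi_t X) j * pd VT F j + lift (xi_s X) j * pd VS F j
     + lift (eta X) j * pd VPhi F j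
     + eta_t X j * pd VPhi_t F j + eta_s X j * pd VPhi_s F j"

definition pr2 :: "vfield \<Rightarrow> (jet \<Rightarrow> real) \<Rightarrow> jet \<Rightarrow> real" where
  "pr2 X F j = pr1 X F j + eta_tt X j * pd VPhi_tt F j
     + eta_ts X j * pd VPhi_ts F j + eta_ss X j * pd VPhi_ss F j"

definition jets_over :: "point set \<Rightarrow> jet set" where
  "jets_over \<Omega> = {j. base j \<in> \<Omega> \<and> j VPhi_s > 0}"

definition point_symmetry :: "point set \<Rightarrow> (jet \<Rightarrow> real) \<Rightarrow> vfield \<Rightarrow> bool" where
  "point_symmetry \<Omega> E X \<longleftrightarrow> Cinf_vfield_on \<Omega> X \<and>
     (\<forall>j\<in>jets_over \<Omega>. E j = 0 \<longrightarrow> pr2 X E j = 0)"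

definition noether_lhs :: "(jet \<Rightarrow> real) \<Rightarrow> vfield \<Rightarrow> jet \<Rightarrow> real" where
  "noether_lhs L X j = pr1 X L j + L j * (Dt (lift (xi_t X)) j + Ds (lift (xi_s X)) j)"

definition noether_symmetry :: "point set \<Rightarrow> (jet \<Rightarrow> real) \<Rightarrow> vfield \<Rightarrow> bool" where
  "noether_symmetry \<Omega> L X \<longleftrightarrow> Cinf_vfield_on \<Omega> X \<and>
     (\<exists>B1 B2. Cinf_on \<Omega> B1 \<and> Cinf_on \<Omega> B2 \<and>
        (\<forall>j\<in>jets_over \<Omega>. noether_lhs L X j = Dt (lift B1) j + Ds (lift B2) j))"

definition variational_symmetry :: "point set \<Rightarrow> (jet \<Rightarrow> real) \<Rightarrow> vfield \<Rightarrow> bool" where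
  "variational_symmetry \<Omega> L X \<longleftrightarrow> Cinf_vfield_on \<Omega> X \<and>
     (\<forall>j\<in>jets_over \<Omega>. noether_lhs L X j = 0)"

(* The conserved current that Noether's theorem attaches to a variational symmetry. *)
definition current_t :: "(jet \<Rightarrow> real) \<Rightarrow> vfield \<Rightarrow> jet \<Rightarrow> real" where
  "current_t L X j = lift (xi_t X) j * L j
     + (lift (eta X) j - lift (xi_t X) j * j VPhi_t - lift (xi_s X) j * j VPhi_s) * pd VPhi_t L j"

definition current_s :: "(jet \<Rightarrow> real) \<Rightarrow> vfield \<Rightarrow> jet \<Rightarrow> real" where
  "current_s L X j = lift (xi_s X) j * L j
     + (lift (eta X) j - lift (xi_t X) j * j VPhi_t - lift (xi_s X) j * j VPhi_s) * pd VPhi_s L j"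

(* Linear span with constant coefficients; X only matters through its restriction to Omega. *)
definition span_on :: "point set \<Rightarrow> vfield set \<Rightarrow> vfield set" where
  "span_on \<Omega> V = {X. \<exists>c. \<forall>p\<in>\<Omega>. X p = (\<Sum>Y\<in>V. c Y *\<^sub>R Y p)}"

definition gas_dom :: "nat \<Rightarrow> point set" where
  "gas_dom n = {(t, s, \<phi>). n \<ge> 1 \<longrightarrow> \<phi> > 0}"

(* The power phi^(n a) is written (phi^n) powr a: the two agree for phi > 0, and for n = 0 the
   latter is 1 for every real phi, whereas 0 powr 0 = 0. *)
definition lagrangian :: "nat \<Rightarrow> real \<Rightarrow> (real \<Rightarrow> real) \<Rightarrow> jet \<Rightarrow> real" where
  "lagrangian n \<gamma> S j = (j VPhi_t)\<^sup>2 / 2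
     - S (j VS) / (\<gamma> - 1) * ((j VPhi ^ n) powr (1 - \<gamma>)) * (j VPhi_s powr (1 - \<gamma>))"

definition gas_eq :: "nat \<Rightarrow> real \<Rightarrow> (real \<Rightarrow> real) \<Rightarrow> jet \<Rightarrow> real" where
  "gas_eq n \<gamma> S j = j VPhi_tt + ((j VPhi ^ n) powr (1 - \<gamma>)) * (j VPhi_s powr (- \<gamma>))
     * (deriv S (j VS) - real n * \<gamma> * S (j VS) * (j VPhi_s / j VPhi)
        - \<gamma> * S (j VS) * (j VPhi_ss / j VPhi_s))"

definition gamma_star :: "nat \<Rightarrow> real" where
  "gamma_star n = (real n + 3) / (real n + 1)"

definition scaling_field :: vfield where
  "scaling_field = (\<lambda>(t, s, \<phi>). (2 * t, 0, \<phi>))"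

definition arbitrary_entropy_fields :: "nat \<Rightarrow> real \<Rightarrow> vfield set" where
  "arbitrary_entropy_fields n \<gamma> =
     {\<lambda>(t, s, \<phi>). (1, 0, 0)}
     \<union> (if n = 0 then {\<lambda>(t, s, \<phi>). (0, 0, 1), \<lambda>(t, s, \<phi>). (0, 0, t)} else {})
     \<union> (if \<gamma> = gamma_star n
         then {scaling_field, \<lambda>(t, s, \<phi>). (t\<^sup>2, 0, t * \<phi>)} else {})"

definition Z2 :: "nat \<Rightarrow> real \<Rightarrow> real \<Rightarrow> vfield" where
  "Z2 n \<gamma> q = (\<lambda>(t, s, \<phi>). (2 * q * t, (real n + 1) * \<gamma> - real n - 3, q * \<phi>))"

definition T2_t :: "nat \<Rightarrow> real \<Rightarrow> real \<Rightarrow> (real \<Rightarrow> real) \<Rightarrow> jet \<Rightarrow> real" where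
  "T2_t n \<gamma> q S j =
     - 2 * q * j VT * ((j VPhi_t)\<^sup>2 / 2
         + S (j VS) / (\<gamma> - 1) * ((j VPhi ^ n) powr (1 - \<gamma>)) * (j VPhi_s powr (1 - \<gamma>)))
     - ((real n + 1) * \<gamma> - real n - 3) * j VPhi_s * j VPhi_t
     + q * j VPhi * j VPhi_t"

(* The power phi^(-n gamma + n + 1) is written phi^(n+1) * (phi^n) powr (-gamma). *)
definition T2_s :: "nat \<Rightarrow> real \<Rightarrow> real \<Rightarrow> (real \<Rightarrow> real) \<Rightarrow> jet \<Rightarrow> real" where
  "T2_s n \<gamma> q S j =
     - 2 * q * j VT * S (j VS) * ((j VPhi ^ n) powr (1 - \<gamma>)) * j VPhi_t * (j VPhi_s powr (- \<gamma>))
     + ((real n + 1) * \<gamma> - real n - 3) * ((j VPhi_t)\<^sup>2 / 2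
         - \<gamma> * S (j VS) / (\<gamma> - 1) * ((j VPhi ^ n) powr (1 - \<gamma>)) * (j VPhi_s powr (1 - \<gamma>)))
     + q * S (j VS) * (j VPhi ^ (n + 1) * (j VPhi ^ n) powr (- \<gamma>)) * (j VPhi_s powr (- \<gamma>))"

end

(*
The Noether condition is an identity in phi_t and phi_s at each point (t, s, phi). It is cubic in
phi_t, and its coefficients are combinations of 1, phi_s, phi_s^(-gamma) and phi_s^(1 - gamma),
which are linearly independent on the half-line phi_s > 0 because gamma > 1. Comparing
coefficients gives the determining equations for X = (a, b, h):
a depends on t and b on s only, h_s = 0, 2 h_phi = a_t - b_s, B1_phi = h_t, and one equation that
links q b to a_t, b_s and h. Differentiating the last one in s gives b_s = 0, since q <> 0. It then
says 2 q b = kappa a_t with kappa = (n + 1) gamma - n - 3, and h = phi a_t / 2 + k with k a function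
of t that vanishes for n > 0. Compatibility of B1_phi = h_t with B1_t + B2_s = 0 and B2_phi = 0
gives h_tt = 0, whence a_ttt = 0 and k_tt = 0. So a is a quadratic polynomial in t, affine unless
kappa = 0, i.e. gamma = gamma_*.

"a depends on t only" is used solely in the form a_s = a_phi = 0. On a connected open set this
does not make a a function of t globally, so only the final quantities, whose full gradient
vanishes, are integrated.
*)
theory Submission
  imports Defs
begin

section \<open>Directional derivatives\<close>

text \<open>Under \<open>t -> l^2 t\<close>, \<open>phi -> l phi\<close> the kinetic part of
  \<open>L dt ds\<close> is invariant, while the potential part picks up the factor
  \<open>l^(-kappa)\<close>. A shift of \<open>s\<close> multiplies the exponential entropy by a
  constant and can absorb that factor: this is the origin of \<open>Z2\<close> and of the relation
  \<open>q * b = a1 * \<kappa>\<close>. The solutions are recorded as the six-parameter family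
  \<open>quad_field\<close>, with \<open>q * b = a1 * \<kappa>\<close>,
  \<open>a2 * \<kappa> = 0\<close>, and \<open>c0 = c1 = 0\<close> for positive \<open>n\<close>.
  Both inclusions of the span equality pass through it: the Noether condition forces this form, and
  its members are checked to be Noether and point symmetries by explicit prolongation. Two obstacles
  shape the computations. For \<open>n = 0\<close> the domain contains \<open>phi = 0\<close>, so
  the logarithmic derivative of \<open>phi^n\<close> is carried as the function \<open>R\<close>,
  and one computation serves all \<open>n\<close>. And closed forms of partial derivatives are known
  only over the domain, so each must be established on an open set of jets before it is
  differentiated again.\<close>

definition dirder :: "'a::euclidean_space \<Rightarrow> ('a \<Rightarrow> real) \<Rightarrow> 'a \<Rightarrow> real" where
  "dirder e f p = frechet_derivative f (at p) e"

lemma dirder_eqI: "(f has_derivative F) (at p) \<Longrightarrow> dirder e f p = F e"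
  unfolding dirder_def by (metis frechet_derivative_at)

lemma has_derivative_dirder:
  "f differentiable at p \<Longrightarrow> (f has_derivative (\<lambda>e. dirder e f p)) (at p)"
  unfolding dirder_def using frechet_derivative_works by fastforce

lemma dirder_const [simp]: "dirder e (\<lambda>_. c) p = 0"
  by (rule dirder_eqI) simp

lemma dirder_linear: "bounded_linear f \<Longrightarrow> dirder e f p = f e"
  by (rule dirder_eqI) (rule bounded_linear_imp_has_derivative)

lemma dirder_add:
  "f differentiable at p \<Longrightarrow> g differentiable at p \<Longrightarrow>
    dirder e (\<lambda>x. f x + g x) p = dirder e f p + dirder e g p"
  by (rule dirder_eqI) (intro has_derivative_add has_derivative_dirder)

lemma dirder_diff:
  "f differentiable at p \<Longrightarrow> g differentiable at p \<Longrightarrow>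
    dirder e (\<lambda>x. f x - g x) p = dirder e f p - dirder e g p"
  by (rule dirder_eqI) (intro has_derivative_diff has_derivative_dirder)

lemma dirder_mult:
  "f differentiable at p \<Longrightarrow> g differentiable at p \<Longrightarrow>
    dirder e (\<lambda>x. f x * g x) p = f p * dirder e g p + dirder e f p * g p"
  by (rule dirder_eqI) (intro has_derivative_mult has_derivative_dirder)

lemma dirder_cmult:
  "f differentiable at p \<Longrightarrow> dirder e (\<lambda>x. c * f x) p = c * dirder e f p"
  using dirder_mult[of "\<lambda>_. c" p f e] by simp

lemma differentiable_cdivide:
  fixes f :: "'a::real_normed_vector \<Rightarrow> real"
  assumes "f differentiable at p"
  shows "(\<lambda>x. f x / c) differentiable at p"
  unfolding divide_inverse using assms by (intro differentiable_mult differentiable_const)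

lemma dirder_cdivide:
  "f differentiable at p \<Longrightarrow> dirder e (\<lambda>x. f x / c) p = dirder e f p / c"
  using dirder_cmult[of f p e "inverse c"] by (simp add: divide_inverse mult.commute)

lemma dirder_cong:
  assumes "open U" "p \<in> U" "\<And>x. x \<in> U \<Longrightarrow> f x = g x" "f differentiable at p"
  shows "dirder e f p = dirder e g p"
  unfolding dirder_def using frechet_derivative_transform_within_open assms by metis

lemma DERIV_dirder:
  assumes "f differentiable at (p + x *\<^sub>R e)"
  shows "((\<lambda>x. f (p + x *\<^sub>R e)) has_real_derivative dirder e f (p + x *\<^sub>R e)) (at x)"
proof -
  have "((\<lambda>x. p + x *\<^sub>R e) has_derivative (\<lambda>h. h *\<^sub>R e)) (at x)"
    by (auto intro!: derivative_eq_intros)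
  from has_derivative_compose[OF this has_derivative_dirder[OF assms]]
  have "((\<lambda>x. f (p + x *\<^sub>R e)) has_derivative
      (\<lambda>h. frechet_derivative f (at (p + x *\<^sub>R e)) (h *\<^sub>R e))) (at x)"
    unfolding dirder_def .
  moreover have "frechet_derivative f (at (p + x *\<^sub>R e)) (h *\<^sub>R e)
      = dirder e f (p + x *\<^sub>R e) * h" for h
    using linear_frechet_derivative[OF assms] by (simp add: linear_cmul dirder_def)
  ultimately show ?thesis
    unfolding has_field_derivative_def by simp
qed

lemma real_eq_if_zero_derivative:
  assumes "\<bar>y\<bar> < \<delta>" "\<And>x. \<bar>x\<bar> < \<delta> \<Longrightarrow> (g has_real_derivative 0) (at x)"
  shows "g y = g 0"
proof -
  have "\<exists>c. \<forall>x\<in>{-\<delta><..<\<delta>}. g x = c"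
    by (rule has_field_derivative_zero_constant)
      (auto intro!: has_field_derivative_at_within assms(2))
  then show ?thesis using assms(1) by (auto simp: abs_less_iff)
qed

text \<open>
  The only instance of Schwarz's theorem that is needed. If \<open>f\<^sub>u\<close> does not vary along \<open>v\<close>, then
  the increment of \<open>f\<close> along \<open>v\<close> does not vary along \<open>u\<close>, so neither does \<open>f\<^sub>v\<close>.
\<close>

lemma mixed_dirder_zero:
  fixes f :: "'a::euclidean_space \<Rightarrow> real"
  assumes U: "open U" "p \<in> U"
    and f: "\<And>x. x \<in> U \<Longrightarrow> f differentiable at x"
    and fu: "\<And>x. x \<in> U \<Longrightarrow> dirder u f differentiable at x"
    and fv: "\<And>x. x \<in> U \<Longrightarrow> dirder v f differentiable at x"
    and zero: "\<And>x. x \<in> U \<Longrightarrow> dirder v (dirder u f) x = 0"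
  shows "dirder u (dirder v f) p = 0"
proof -
  obtain e where e: "e > 0" "ball p e \<subseteq> U"
    using U open_contains_ball by blast
  \<comment> \<open>Small enough that the whole parallelogram \<open>p + x u + y v\<close> with
    \<open>x\<close>, \<open>y\<close> below \<delta> in absolute value stays in the ball; the
    summand 1 keeps the denominator positive when both directions are zero.\<close>
  define \<delta> where "\<delta> = e / (norm u + norm v + 1)"
  have pos: "norm u + norm v + 1 > 0"
    by (simp add: add_nonneg_pos)
  have \<delta>: "\<delta> > 0"
    using e pos by (simp add: \<delta>_def)
  have inU: "p + x *\<^sub>R u + y *\<^sub>R v \<in> U" if "\<bar>x\<bar> < \<delta>" "\<bar>y\<bar> < \<delta>" for x y
  proof -
    have "norm (x *\<^sub>R u + y *\<^sub>R v) \<le> \<bar>x\<bar> * norm u + \<bar>y\<bar> * norm v"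
      using norm_triangle_ineq[of "x *\<^sub>R u" "y *\<^sub>R v"] by simp
    also have "\<dots> \<le> \<delta> * norm u + \<delta> * norm v"
      using that by (intro add_mono mult_right_mono) auto
    also have "\<dots> < \<delta> * (norm u + norm v + 1)"
      using \<delta> by (simp add: algebra_simps)
    also have "\<dots> = e"
      using pos by (simp add: \<delta>_def)
    finally have "norm (x *\<^sub>R u + y *\<^sub>R v) < e" .
    then have "p + (x *\<^sub>R u + y *\<^sub>R v) \<in> ball p e"
      by (simp only: mem_ball dist_norm norm_minus_commute[of p] add_diff_cancel_left')
    then have "p + x *\<^sub>R u + y *\<^sub>R v \<in> ball p e"
      by (simp only: add.assoc)
    then show ?thesis using e by blast
  qed
  have inU1: "p + x *\<^sub>R u \<in> U" "p + x *\<^sub>R v \<in> U" if "\<bar>x\<bar> < \<delta>" for x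
    using inU[OF that, of 0] inU[of 0 x] that \<delta> by auto
  have fu_const: "dirder u f (p + x *\<^sub>R u + y *\<^sub>R v) = dirder u f (p + x *\<^sub>R u)"
    if "\<bar>x\<bar> < \<delta>" "\<bar>y\<bar> < \<delta>" for x y
  proof -
    have "dirder u f (p + x *\<^sub>R u + y *\<^sub>R v) = dirder u f (p + x *\<^sub>R u + 0 *\<^sub>R v)"
    proof (rule real_eq_if_zero_derivative[where y = y, OF that(2)])
      fix z :: real assume "\<bar>z\<bar> < \<delta>"
      then show "((\<lambda>y. dirder u f (p + x *\<^sub>R u + y *\<^sub>R v)) has_real_derivative 0) (at z)"
        using DERIV_dirder[OF fu[OF inU[OF that(1)]], of z] zero[OF inU[OF that(1)], of z] by simp
    qed
    then show ?thesis by simp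
  qed
  \<comment> \<open>On the parallelogram \<open>f\<close> separates into a function of
    \<open>x\<close> plus a function of \<open>y\<close>.\<close>
  have increment: "f (p + x *\<^sub>R u + y *\<^sub>R v) = f (p + y *\<^sub>R v) + (f (p + x *\<^sub>R u) - f p)"
    if "\<bar>x\<bar> < \<delta>" "\<bar>y\<bar> < \<delta>" for x y
  proof -
    have "f ((p + y *\<^sub>R v) + x *\<^sub>R u) - f (p + x *\<^sub>R u)
        = f ((p + y *\<^sub>R v) + 0 *\<^sub>R u) - f (p + 0 *\<^sub>R u)"
    proof (rule real_eq_if_zero_derivative[where y = x, OF that(1)])
      fix z :: real assume z: "\<bar>z\<bar> < \<delta>"
      have eq: "p + y *\<^sub>R v + z *\<^sub>R u = p + z *\<^sub>R u + y *\<^sub>R v"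
        by (rule add.commute[of "y *\<^sub>R v", THEN arg_cong[where f = "(+) p"], folded add.assoc])
      have "((\<lambda>x. f ((p + y *\<^sub>R v) + x *\<^sub>R u) - f (p + x *\<^sub>R u)) has_real_derivative
          dirder u f ((p + y *\<^sub>R v) + z *\<^sub>R u) - dirder u f (p + z *\<^sub>R u)) (at z)"
        by (intro DERIV_diff DERIV_dirder f) (use inU[OF z that(2)] inU1[OF z] in \<open>simp_all only: eq\<close>)
      then show "((\<lambda>x. f ((p + y *\<^sub>R v) + x *\<^sub>R u) - f (p + x *\<^sub>R u))
          has_real_derivative 0) (at z)"
        unfolding eq using fu_const[OF z that(2)] by simp
    qed
    then show ?thesis by (simp add: algebra_simps)
  qed
  \<comment> \<open>By \<open>increment\<close> the restrictions of \<open>f\<close> to the parallel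
    lines through \<open>p\<close> and \<open>p + x u\<close> differ by a constant, so their slopes
    at \<open>y = 0\<close> agree.\<close>
  have fv_const: "dirder v f (p + x *\<^sub>R u) = dirder v f p" if x: "\<bar>x\<bar> < \<delta>" for x
  proof (rule DERIV_unique)
    show "((\<lambda>y. f (p + x *\<^sub>R u + y *\<^sub>R v)) has_real_derivative dirder v f (p + x *\<^sub>R u)) (at 0)"
      using DERIV_dirder[of f "p + x *\<^sub>R u" 0 v] f inU1[OF x] by simp
    have "((\<lambda>y. f (p + y *\<^sub>R v) + (f (p + x *\<^sub>R u) - f p))
        has_real_derivative dirder v f p) (at 0)"
      using DERIV_dirder[of f p 0 v] f U by (auto intro!: derivative_eq_intros)
    then show "((\<lambda>y. f (p + x *\<^sub>R u + y *\<^sub>R v)) has_real_derivative dirder v f p) (at 0)"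
      by (rule has_field_derivative_transform_within_open[where S = "{-\<delta><..<\<delta>}"])
        (use \<delta> increment[OF x] in auto)
  qed
  show ?thesis
  proof (rule DERIV_unique)
    show "((\<lambda>x. dirder v f (p + x *\<^sub>R u)) has_real_derivative dirder u (dirder v f) p) (at 0)"
      using DERIV_dirder[of "dirder v f" p 0 u] fv U by simp
    show "((\<lambda>x. dirder v f (p + x *\<^sub>R u)) has_real_derivative 0) (at 0)"
      by (rule has_field_derivative_transform_within_open
          [where S = "{-\<delta><..<\<delta>}" and f = "\<lambda>_. dirder v f p"])
        (use \<delta> fv_const in auto)
  qed
qed

lemma constant_if_dirder_zero:
  assumes "open U" "connected U"
    and f: "\<And>x. x \<in> U \<Longrightarrow> f differentiable at x"
    and zero: "\<And>x b. x \<in> U \<Longrightarrow> b \<in> Basis \<Longrightarrow> dirder b f x = 0"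
  obtains c where "\<And>x. x \<in> U \<Longrightarrow> f x = c"
proof -
  have "(f has_derivative (\<lambda>h. 0)) (at x)" if "x \<in> U" for x
  proof -
    have "linear (\<lambda>h. dirder h f x)"
      using has_derivative_linear[OF has_derivative_dirder[OF f[OF that]]] .
    then have "(\<lambda>h. dirder h f x) = (\<lambda>h. 0)"
      by (rule linear_eq_stdbasis) (auto simp: zero that intro: linear_zero)
    then show ?thesis using has_derivative_dirder[OF f[OF that]] by simp
  qed
  then have "\<And>x y. x \<in> U \<Longrightarrow> y \<in> U \<Longrightarrow> f x = f y"
    using has_derivative_zero_unique_connected[OF assms(1,2)] by blast
  then show ?thesis using that by (metis (full_types))
qed

section \<open>Smooth functions\<close>

text \<open>The sum and product rules hold only at points of \<open>U\<close>, so the derivatives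
  they produce must be exchanged on \<open>U\<close> alone; openness makes the derivatives of
  \<open>f\<close> and \<open>g\<close> agree there.\<close>

lemma Ck_on_cong:
  assumes "open U" "\<And>x. x \<in> U \<Longrightarrow> f x = g x" "Ck_on k U f"
  shows "Ck_on k U g"
  using assms(2,3)
proof (induction k arbitrary: f g)
  case 0
  then show ?case by (auto cong: continuous_on_cong)
next
  case (Suc k)
  have f: "f differentiable at x" if "x \<in> U" for x
    using Suc.prems that assms(1) by (auto simp: differentiable_on_eq_differentiable_at)
  have "g differentiable_on U"
    unfolding differentiable_on_eq_differentiable_at[OF assms(1)]
    using f assms(1) Suc.prems(1) has_derivative_transform_within_open
    unfolding differentiable_def by metis
  moreover have "Ck_on k U (\<lambda>x. frechet_derivative g (at x) b)" if "b \<in> Basis" for b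
    by (rule Suc.IH[of "\<lambda>x. frechet_derivative f (at x) b"])
      (use Suc.prems that f assms(1) frechet_derivative_transform_within_open[of f _ U g] in auto)
  ultimately show ?case by simp
qed

lemma Ck_on_Suc_imp: "Ck_on (Suc k) U f \<Longrightarrow> Ck_on k U f"
  by (induction k arbitrary: f) (auto simp: differentiable_imp_continuous_on)

lemma Ck_on_const: "Ck_on k U (\<lambda>_. c)"
  by (induction k arbitrary: c) (auto simp: differentiable_on_def)

lemma Ck_on_linear:
  assumes "bounded_linear f"
  shows "Ck_on k U f"
proof -
  have "f differentiable at x within U" for x
    using assms by (rule bounded_linear_imp_differentiable)
  moreover have "(\<lambda>x. frechet_derivative f (at x) b) = (\<lambda>_. f b)" for b
    using dirder_linear[OF assms] by (simp add: dirder_def)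
  moreover have "continuous_on U f"
    using assms by (rule linear_continuous_on)
  ultimately show ?thesis
    by (cases k) (auto simp: differentiable_on_def Ck_on_const)
qed

lemma Ck_on_add:
  assumes "open U"
  shows "Ck_on k U f \<Longrightarrow> Ck_on k U g \<Longrightarrow> Ck_on k U (\<lambda>x. f x + g x)"
proof (induction k arbitrary: f g)
  case 0
  then show ?case by (auto intro: continuous_on_add)
next
  case (Suc k)
  have d: "f differentiable at x" "g differentiable at x" if "x \<in> U" for x
    using Suc.prems that assms by (auto simp: differentiable_on_eq_differentiable_at)
  have "Ck_on k U (\<lambda>x. frechet_derivative (\<lambda>x. f x + g x) (at x) b)" if "b \<in> Basis" for b
    by (rule Ck_on_cong[OF assms _ Suc.IH])
      (use Suc.prems that d dirder_add[of f _ g b] in \<open>auto simp: dirder_def\<close>)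
  then show ?case using Suc.prems by auto
qed

text \<open>The product rule leaves one factor undifferentiated, so the regularity of that factor is
  lowered by \<open>Ck_on_Suc_imp\<close> before the induction hypothesis applies.\<close>

lemma Ck_on_mult:
  assumes "open U"
  shows "Ck_on k U f \<Longrightarrow> Ck_on k U g \<Longrightarrow> Ck_on k U (\<lambda>x. f x * g x)"
proof (induction k arbitrary: f g)
  case 0
  then show ?case by (auto intro: continuous_on_mult)
next
  case (Suc k)
  have d: "f differentiable at x" "g differentiable at x" if "x \<in> U" for x
    using Suc.prems that assms by (auto simp: differentiable_on_eq_differentiable_at)
  have "Ck_on k U (\<lambda>x. frechet_derivative (\<lambda>x. f x * g x) (at x) b)" if "b \<in> Basis" for b
  proof (rule Ck_on_cong[OF assms _ Ck_on_add[OF assms Suc.IH Suc.IH]])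
    show "f x * frechet_derivative g (at x) b + frechet_derivative f (at x) b * g x
        = frechet_derivative (\<lambda>x. f x * g x) (at x) b" if "x \<in> U" for x
      using dirder_mult[OF d[OF that], of b] by (simp add: dirder_def)
  qed (use Suc.prems that Ck_on_Suc_imp in \<open>auto intro: Ck_on_Suc_imp\<close>)
  then show ?case using Suc.prems by auto
qed

lemma Cinf_on_cong:
  "open U \<Longrightarrow> (\<And>x. x \<in> U \<Longrightarrow> f x = g x) \<Longrightarrow> Cinf_on U f \<Longrightarrow> Cinf_on U g"
  unfolding Cinf_on_def using Ck_on_cong by blast

lemma Cinf_on_const: "Cinf_on U (\<lambda>_. c)"
  by (simp add: Cinf_on_def Ck_on_const)

lemma Cinf_on_linear: "bounded_linear f \<Longrightarrow> Cinf_on U f"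
  by (simp add: Cinf_on_def Ck_on_linear)

lemma Cinf_on_add: "open U \<Longrightarrow> Cinf_on U f \<Longrightarrow> Cinf_on U g \<Longrightarrow> Cinf_on U (\<lambda>x. f x + g x)"
  by (simp add: Cinf_on_def Ck_on_add)

lemma Cinf_on_mult: "open U \<Longrightarrow> Cinf_on U f \<Longrightarrow> Cinf_on U g \<Longrightarrow> Cinf_on U (\<lambda>x. f x * g x)"
  by (simp add: Cinf_on_def Ck_on_mult)

lemma Cinf_on_dirder: "Cinf_on U f \<Longrightarrow> b \<in> Basis \<Longrightarrow> Cinf_on U (dirder b f)"
  unfolding Cinf_on_def dirder_def by (metis Ck_on.simps(2))

lemma Cinf_on_differentiable: "Cinf_on U f \<Longrightarrow> open U \<Longrightarrow> x \<in> U \<Longrightarrow> f differentiable at x"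
  unfolding Cinf_on_def by (metis Ck_on.simps(2) differentiable_on_eq_differentiable_at)

lemma Cinf_on_mixed_zero:
  assumes "Cinf_on U f" "open U" "u \<in> Basis" "v \<in> Basis"
    "\<And>x. x \<in> U \<Longrightarrow> dirder v (dirder u f) x = 0" "p \<in> U"
  shows "dirder u (dirder v f) p = 0"
proof (rule mixed_dirder_zero[of U])
  show "f differentiable at x" if "x \<in> U" for x
    using assms that by (blast intro: Cinf_on_differentiable)
  show "dirder u f differentiable at x" "dirder v f differentiable at x" if "x \<in> U" for x
    using Cinf_on_dirder[OF assms(1)] assms that by (blast intro: Cinf_on_differentiable)+
qed (use assms in auto)

lemma dirder_zero_if_constant_on:
  assumes "open U" "p \<in> U" "\<And>x. x \<in> U \<Longrightarrow> f x = c"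
  shows "dirder e f p = 0"
  using dirder_cong[OF assms(1,2), of "\<lambda>_. c" f e] assms(3) by simp

text \<open>This is how independence of a variable passes to derivatives: \<open>f_v = 0\<close> on
  \<open>U\<close> gives \<open>f_vu = 0\<close>, and the mixed derivatives are then
  exchanged.\<close>

lemma Cinf_on_mixed_zero_if_dirder_zero:
  assumes "Cinf_on U f" "open U" "u \<in> Basis" "v \<in> Basis"
    "\<And>x. x \<in> U \<Longrightarrow> dirder v f x = 0" "p \<in> U"
  shows "dirder v (dirder u f) p = 0"
  by (rule Cinf_on_mixed_zero[OF assms(1,2,4,3) dirder_zero_if_constant_on[OF assms(2)] assms(6)])
    (use assms(5) in auto)

section \<open>Functions on jet space\<close>

abbreviation d_t :: "(point \<Rightarrow> real) \<Rightarrow> point \<Rightarrow> real" where "d_t \<equiv> dirder (1, 0, 0)"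
abbreviation d_s :: "(point \<Rightarrow> real) \<Rightarrow> point \<Rightarrow> real" where "d_s \<equiv> dirder (0, 1, 0)"
abbreviation d_phi :: "(point \<Rightarrow> real) \<Rightarrow> point \<Rightarrow> real" where "d_phi \<equiv> dirder (0, 0, 1)"

lemma Basis_point: "(Basis :: point set) = {(1, 0, 0), (0, 1, 0), (0, 0, 1)}"
  by (auto simp: Basis_prod_def zero_prod_def)

lemma dirder_coordinates:
  "dirder e fst p = fst e" "dirder e (\<lambda>p :: point. snd (snd p)) p = snd (snd e)"
  by (auto intro!: dirder_linear bounded_linear_intros)

lemma differentiable_coordinates:
  "(fst :: point \<Rightarrow> real) differentiable at p"
  "(\<lambda>p :: point. snd (snd p)) differentiable at p"
  by (auto intro!: bounded_linear_imp_differentiable bounded_linear_intros)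

lemma constant_if_gradient_zero:
  fixes \<Omega> :: "point set"
  assumes "open \<Omega>" "connected \<Omega>" "\<And>x. x \<in> \<Omega> \<Longrightarrow> f differentiable at x"
    and "\<And>x. x \<in> \<Omega> \<Longrightarrow> d_t f x = 0" "\<And>x. x \<in> \<Omega> \<Longrightarrow> d_s f x = 0" "\<And>x. x \<in> \<Omega> \<Longrightarrow> d_phi f x = 0"
  obtains c where "\<And>x. x \<in> \<Omega> \<Longrightarrow> f x = c"
proof (rule constant_if_dirder_zero[of \<Omega> f])
  show "dirder b f x = 0" if "x \<in> \<Omega>" "b \<in> Basis" for b x
    using that(2) assms(4-6)[OF that(1)] unfolding Basis_point by blast
qed (use assms that in blast)+

section \<open>Partial and total derivatives of functions on jet space\<close>

lemma pd_eqI: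
  "((\<lambda>x. F (j(c := x))) has_real_derivative d) (at (j c)) \<Longrightarrow> pd c F j = d"
  unfolding pd_def by (rule DERIV_imp_deriv)

text \<open>Separates the derivative found by differentiation rules from the closed form claimed for
  it, leaving an algebraic equation between the two.\<close>

lemmas pd_eqI' = pd_eqI[OF DERIV_cong]
lemmas coord_upd = fun_upd_apply coord.distinct simp_thms(6) if_True if_False

lemma pd_lift:
  assumes f: "f differentiable at (base j)"
  shows "pd VT (lift f) j = d_t f (base j)"
    and "pd VS (lift f) j = d_s f (base j)"
    and "pd VPhi (lift f) j = d_phi f (base j)"
    and "c \<notin> {VT, VS, VPhi} \<Longrightarrow> pd c (lift f) j = 0"
proof -
  \<comment> \<open>Changing one coordinate of \<open>j\<close> moves \<open>base j\<close> along an
    axis; the shift by \<open>y\<close> places the base point itself at the parameter where the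
    derivative is taken.\<close>
  have along: "((\<lambda>x. f (base j + (x - y) *\<^sub>R e)) has_real_derivative dirder e f (base j)) (at y)"
    for e and y :: real
  proof -
    have "((\<lambda>x. f (base j + x *\<^sub>R e)) has_real_derivative dirder e f (base j)) (at (y - y))"
      using DERIV_dirder[of f "base j" 0 e] f by simp
    moreover have "((\<lambda>x. x - y) has_real_derivative 1) (at y)"
      by (auto intro!: derivative_eq_intros)
    ultimately show ?thesis
      using DERIV_chain2[of "\<lambda>x. f (base j + x *\<^sub>R e)" _ "\<lambda>x. x - y" y 1] by simp
  qed
  show "pd VT (lift f) j = d_t f (base j)"
    by (rule pd_eqI) (use along[where e = "(1, 0, 0)" and y = "j VT"] in
        \<open>simp add: lift_def base_def add_diff_eq\<close>)
  show "pd VS (lift f) j = d_s f (base j)"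
    by (rule pd_eqI) (use along[where e = "(0, 1, 0)" and y = "j VS"] in
        \<open>simp add: lift_def base_def add_diff_eq\<close>)
  show "pd VPhi (lift f) j = d_phi f (base j)"
    by (rule pd_eqI) (use along[where e = "(0, 0, 1)" and y = "j VPhi"] in
        \<open>simp add: lift_def base_def add_diff_eq\<close>)
  show "pd c (lift f) j = 0" if "c \<notin> {VT, VS, VPhi}"
    by (rule pd_eqI) (use that in \<open>auto simp: lift_def base_def\<close>)
qed

lemma Dt_lift:
  "f differentiable at (base j) \<Longrightarrow>
    Dt (lift f) j = d_t f (base j) + j VPhi_t * d_phi f (base j)"
  by (simp add: Dt_def pd_lift)

lemma Ds_lift:
  "f differentiable at (base j) \<Longrightarrow>
    Ds (lift f) j = d_s f (base j) + j VPhi_s * d_phi f (base j)"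
  by (simp add: Ds_def pd_lift)

text \<open>Membership of the base point in an open set and positivity of \<open>phi_s\<close> both
  survive small changes of one coordinate. Hence \<open>pd\<close> at such a jet sees only values
  over the domain.\<close>

lemma eventually_jets_over:
  assumes "open \<Omega>" "j \<in> jets_over \<Omega>"
  shows "\<forall>\<^sub>F x in nhds (j c). j(c := x) \<in> jets_over \<Omega>"
proof -
  have "continuous (at (j c)) (\<lambda>x. base (j(c := x)))"
    unfolding base_def by (cases c) (auto intro!: continuous_intros)
  then have "((\<lambda>x. base (j(c := x))) \<longlongrightarrow> base j) (nhds (j c))"
    by (simp add: continuous_at tendsto_nhds_iff fun_upd_idem)
  then have base: "\<forall>\<^sub>F x in nhds (j c). base (j(c := x)) \<in> \<Omega>"
    using assms by (auto simp: jets_over_def dest: topological_tendstoD)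
  have "((\<lambda>x. (j(c := x)) VPhi_s) \<longlongrightarrow> j VPhi_s) (nhds (j c))"
    by (cases "c = VPhi_s") (auto simp: filterlim_ident)
  then have "\<forall>\<^sub>F x in nhds (j c). (j(c := x)) VPhi_s > 0"
    using assms by (intro order_tendstoD(1)) (auto simp: jets_over_def)
  with base show ?thesis
    by eventually_elim (auto simp: jets_over_def)
qed

lemma pd_cong:
  assumes "open \<Omega>" "\<And>j. j \<in> jets_over \<Omega> \<Longrightarrow> F j = G j" "j \<in> jets_over \<Omega>"
  shows "pd c F j = pd c G j"
  unfolding pd_def
  by (rule deriv_cong_ev[OF eventually_mono[OF eventually_jets_over[OF assms(1,3)]]])
    (auto simp: assms(2))

lemma Dt_cong:
  assumes "open \<Omega>" "\<And>j. j \<in> jets_over \<Omega> \<Longrightarrow> F j = G j" "j \<in> jets_over \<Omega>"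
  shows "Dt F j = Dt G j"
  using pd_cong[OF assms] by (simp add: Dt_def)

lemma Ds_cong:
  assumes "open \<Omega>" "\<And>j. j \<in> jets_over \<Omega> \<Longrightarrow> F j = G j" "j \<in> jets_over \<Omega>"
  shows "Ds F j = Ds G j"
  using pd_cong[OF assms] by (simp add: Ds_def)

lemma jets_over_mono: "\<Omega> \<subseteq> \<Omega>' \<Longrightarrow> jets_over \<Omega> \<subseteq> jets_over \<Omega>'"
  by (auto simp: jets_over_def)

lemma open_gas_dom: "open (gas_dom n)"
proof (cases "n \<ge> 1")
  case True
  then have "gas_dom n = {p. snd (snd p) > 0}"
    by (auto simp: gas_dom_def)
  then show ?thesis by (simp add: open_Collect_less continuous_intros)
next
  case False
  then have "gas_dom n = UNIV" by (auto simp: gas_dom_def)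
  then show ?thesis by simp
qed

lemma DERIV_powr_const:
  fixes x r :: real
  shows "x > 0 \<Longrightarrow> ((\<lambda>x. x powr r) has_real_derivative r * x powr r / x) (at x)"
  by (rule DERIV_cong[OF has_real_derivative_powr]) (auto simp: powr_diff)

text \<open>For \<open>n = 0\<close> the function is constantly 1 and the factor
  \<open>real n\<close> kills the quotient, so the formula also covers \<open>x = 0\<close>.\<close>

lemma DERIV_power_powr:
  fixes x r :: real
  assumes "x > 0 \<or> n = 0"
  shows "((\<lambda>x. (x ^ n) powr r) has_real_derivative real n * r * (x ^ n) powr r / x) (at x)"
proof (cases "n = 0")
  case False
  then have "x > 0" "n > 0" using assms by auto
  then have "((\<lambda>x. (x ^ n) powr r) has_real_derivative
      r * (x ^ n) powr r / x ^ n * (real n * x ^ (n - 1))) (at x)"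
    by (intro DERIV_chain2[OF DERIV_powr_const]) (auto intro!: derivative_eq_intros)
  moreover from \<open>n > 0\<close> have "x ^ n = x * x ^ (n - 1)"
    by (simp add: power_eq_if)
  then have "r * (x ^ n) powr r / x ^ n * (real n * x ^ (n - 1)) = real n * r * (x ^ n) powr r / x"
    using \<open>x > 0\<close> by (simp add: divide_simps)
  ultimately show ?thesis by simp
qed simp

section \<open>The Lagrangian and the conservation law\<close>

locale exponential_gas =
  fixes n :: nat and \<gamma> A0 q :: real and S :: "real \<Rightarrow> real"
  assumes \<gamma>: "\<gamma> > 1" and A0: "A0 > 0" and q: "q \<noteq> 0" and S: "S = (\<lambda>s. A0 * exp (q * s))"
begin

abbreviation "J \<equiv> jets_over (gas_dom n)"

text \<open>The real powers are made opaque: each of \<open>S\<close>, \<open>P\<close>,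
  \<open>W\<close> is reproduced up to a factor when differentiated, so later identities are
  rational in these values, \<open>R\<close> and the jet coordinates.\<close>

definition "P \<phi> = (\<phi> ^ n) powr (1 - \<gamma>)"
definition "W w = w powr (1 - \<gamma>)" for w :: real
(* For n = 0 this is 0 everywhere, in particular at phi = 0, which is then in the domain. *)
definition "R \<phi> = real n / \<phi>"

lemma J_D:
  assumes "j \<in> J"
  shows "j VPhi > 0 \<or> n = 0" "j VPhi_s > 0" "j VPhi_s \<noteq> 0"
  using assms by (auto simp: jets_over_def gas_dom_def base_def)

lemma gamma_minus_one: "\<gamma> - 1 \<noteq> 0"
  using \<gamma> by simp

lemma S_pos: "S s > 0"
  using A0 by (simp add: S)

lemma P_pos: "\<phi> > 0 \<or> n = 0 \<Longrightarrow> P \<phi> > 0"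
  by (auto simp: P_def)

lemma W_pos: "w > 0 \<Longrightarrow> W w > 0"
  by (simp add: W_def)

lemma powr_minus_gamma: "w > 0 \<Longrightarrow> w powr - \<gamma> = W w / w" for w :: real
  by (simp add: W_def powr_diff powr_minus divide_simps)

lemma DERIV_S: "(S has_real_derivative q * S s) (at s)"
  unfolding S by (auto intro!: derivative_eq_intros)

lemma DERIV_P: "\<phi> > 0 \<or> n = 0 \<Longrightarrow> (P has_real_derivative (1 - \<gamma>) * R \<phi> * P \<phi>) (at \<phi>)"
  unfolding P_def R_def by (rule DERIV_cong[OF DERIV_power_powr]) auto

lemma DERIV_W: "w > 0 \<Longrightarrow> (W has_real_derivative (1 - \<gamma>) * W w / w) (at w)"
  unfolding W_def by (rule DERIV_powr_const)

lemma DERIV_R: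
  assumes "\<phi> > 0 \<or> n = 0"
  shows "(R has_real_derivative - (R \<phi> / \<phi>)) (at \<phi>)"
proof (cases "n = 0")
  case False
  then show ?thesis
    unfolding R_def using assms
    by (auto intro!: derivative_eq_intros simp: power2_eq_square)
next
  case True
  then have "R = (\<lambda>_. 0)" unfolding R_def by simp
  then show ?thesis by simp
qed

(* DERIV_cdivide comes first so that a constant denominator needs no proof of being nonzero. *)
lemmas gas_DERIV = DERIV_cdivide[THEN DERIV_cong] DERIV_S[THEN DERIV_cong] DERIV_P[THEN DERIV_cong]
  DERIV_W[THEN DERIV_cong] DERIV_R[THEN DERIV_cong]

lemma lagrangian_eq: "lagrangian n \<gamma> S =
    (\<lambda>j. (j VPhi_t)\<^sup>2 / 2 - S (j VS) / (\<gamma> - 1) * P (j VPhi) * W (j VPhi_s))"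
  unfolding lagrangian_def P_def W_def ..

lemma gas_eq_eq:
  assumes "j \<in> J"
  shows "gas_eq n \<gamma> S j = j VPhi_tt + P (j VPhi) * (W (j VPhi_s) / j VPhi_s)
     * S (j VS) * (q - \<gamma> * R (j VPhi) * j VPhi_s - \<gamma> * (j VPhi_ss / j VPhi_s))"
proof -
  have "deriv S (j VS) - real n * \<gamma> * S (j VS) * (j VPhi_s / j VPhi)
        - \<gamma> * S (j VS) * (j VPhi_ss / j VPhi_s)
      = S (j VS) * (q - \<gamma> * R (j VPhi) * j VPhi_s - \<gamma> * (j VPhi_ss / j VPhi_s))"
    unfolding DERIV_imp_deriv[OF DERIV_S] R_def by (simp add: algebra_simps)
  then show ?thesis
    using J_D[OF assms] unfolding gas_eq_def P_def by (simp add: powr_minus_gamma mult.assoc)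
qed

lemma pd_lagrangian:
  assumes "j \<in> J"
  shows "pd VT (lagrangian n \<gamma> S) j = 0"
    and "pd VS (lagrangian n \<gamma> S) j
      = - (q * S (j VS) * P (j VPhi) * W (j VPhi_s) / (\<gamma> - 1))"
    and "pd VPhi (lagrangian n \<gamma> S) j
      = R (j VPhi) * S (j VS) * P (j VPhi) * W (j VPhi_s)"
    and "pd VPhi_t (lagrangian n \<gamma> S) j = j VPhi_t"
    and "pd VPhi_s (lagrangian n \<gamma> S) j
      = S (j VS) * P (j VPhi) * W (j VPhi_s) / j VPhi_s"
proof -
  show "pd VT (lagrangian n \<gamma> S) j = 0"
    unfolding lagrangian_eq
    by (insert J_D[OF assms(1)] gamma_minus_one, rule pd_eqI', simp only: coord_upd, (rule gas_DERIV derivative_eq_intros refl | assumption)+,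
      (simp add: field_simps)?)
  show "pd VS (lagrangian n \<gamma> S) j
      = - (q * S (j VS) * P (j VPhi) * W (j VPhi_s) / (\<gamma> - 1))"
    unfolding lagrangian_eq
    by (insert J_D[OF assms(1)] gamma_minus_one, rule pd_eqI', simp only: coord_upd, (rule gas_DERIV derivative_eq_intros refl | assumption)+,
      (simp add: field_simps)?)
  show "pd VPhi (lagrangian n \<gamma> S) j
      = R (j VPhi) * S (j VS) * P (j VPhi) * W (j VPhi_s)"
    unfolding lagrangian_eq
    by (insert J_D[OF assms(1)] gamma_minus_one, rule pd_eqI', simp only: coord_upd, (rule gas_DERIV derivative_eq_intros refl | assumption)+,
      (simp add: field_simps)?)
  show "pd VPhi_t (lagrangian n \<gamma> S) j = j VPhi_t"
    unfolding lagrangian_eq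
    by (insert J_D[OF assms(1)] gamma_minus_one, rule pd_eqI', simp only: coord_upd, (rule gas_DERIV derivative_eq_intros refl | assumption)+,
      (simp add: field_simps)?)
  show "pd VPhi_s (lagrangian n \<gamma> S) j
      = S (j VS) * P (j VPhi) * W (j VPhi_s) / j VPhi_s"
    unfolding lagrangian_eq
    by (insert J_D[OF assms(1)] gamma_minus_one, rule pd_eqI', simp only: coord_upd, (rule gas_DERIV derivative_eq_intros refl | assumption)+,
      (simp add: field_simps)?)
qed

text \<open>\<open>G\<close> is the derivative of \<open>L\<close> in \<open>phi_s\<close>; for a
  gas of density \<open>1 / (phi^n phi_s)\<close> it is \<open>phi^n\<close> times the pressure. Its
  derivatives supply the \<open>Ds\<close> term of the Euler-Lagrange expression.\<close>

lemma pd_pressure: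
  fixes j :: jet
  assumes "j \<in> J"
  defines "G \<equiv> \<lambda>j. S (j VS) * P (j VPhi) * W (j VPhi_s) / j VPhi_s"
  shows "pd VS G j = q * G j"
    and "pd VPhi G j = (1 - \<gamma>) * R (j VPhi) * G j"
    and "pd VPhi_t G j = 0"
    and "pd VPhi_s G j = - \<gamma> * G j / j VPhi_s"
proof -
  show "pd VS G j = q * G j"
    unfolding G_def
    by (insert J_D[OF assms(1)] gamma_minus_one, rule pd_eqI', simp only: coord_upd, (rule gas_DERIV derivative_eq_intros refl | assumption)+,
      (simp add: field_simps)?)
  show "pd VPhi G j = (1 - \<gamma>) * R (j VPhi) * G j"
    unfolding G_def
    by (insert J_D[OF assms(1)] gamma_minus_one, rule pd_eqI', simp only: coord_upd, (rule gas_DERIV derivative_eq_intros refl | assumption)+,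
      (simp add: field_simps)?)
  show "pd VPhi_t G j = 0"
    unfolding G_def
    by (insert J_D[OF assms(1)] gamma_minus_one, rule pd_eqI', simp only: coord_upd, (rule gas_DERIV derivative_eq_intros refl | assumption)+,
      (simp add: field_simps)?)
  show "pd VPhi_s G j = - \<gamma> * G j / j VPhi_s"
    unfolding G_def
    by (insert J_D[OF assms(1)] gamma_minus_one, rule pd_eqI', simp only: coord_upd, (rule gas_DERIV derivative_eq_intros refl | assumption)+,
      (simp add: field_simps)?)
qed

text \<open>The coefficient \<gamma> of \<open>R\<close> in the gas equation arises as
  \<open>1 - (1 - \<gamma>)\<close>: one contribution from the \<open>phi\<close>-derivative of
  \<open>L\<close>, the other from \<open>Ds\<close> acting on \<open>P\<close>.\<close>

lemma euler_lagrange_lagrangian: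
  assumes "j \<in> J"
  shows "euler_lagrange (lagrangian n \<gamma> S) j = - gas_eq n \<gamma> S j"
proof -
  have "Dt (pd VPhi_t (lagrangian n \<gamma> S)) j = Dt (\<lambda>j. j VPhi_t) j"
    by (rule Dt_cong[OF open_gas_dom pd_lagrangian(4) assms])
  also have "\<dots> = j VPhi_tt"
    by (simp add: Dt_def pd_def)
  finally have t: "Dt (pd VPhi_t (lagrangian n \<gamma> S)) j = j VPhi_tt" .
  have s: "Ds (pd VPhi_s (lagrangian n \<gamma> S)) j
      = Ds (\<lambda>j. S (j VS) * P (j VPhi) * W (j VPhi_s) / j VPhi_s) j"
    by (rule Ds_cong[OF open_gas_dom pd_lagrangian(5) assms])
  show ?thesis
    unfolding euler_lagrange_def t s
    unfolding Ds_def pd_pressure[OF assms] pd_lagrangian[OF assms]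
      gas_eq_eq[OF assms]
    using J_D[OF assms] by (simp add: field_simps)
qed

section \<open>The conserved current of \<open>Z2\<close>\<close>

lemma T2_t_eq:
  "T2_t n \<gamma> q S = (\<lambda>j. - 2 * q * j VT * ((j VPhi_t)\<^sup>2 / 2
         + S (j VS) / (\<gamma> - 1) * P (j VPhi) * W (j VPhi_s))
     - ((real n + 1) * \<gamma> - real n - 3) * j VPhi_s * j VPhi_t
     + q * j VPhi * j VPhi_t)"
  unfolding T2_t_def P_def W_def ..

lemma T2_s_eq:
  assumes "j \<in> J"
  shows "T2_s n \<gamma> q S j =
     - 2 * q * j VT * S (j VS) * P (j VPhi) * j VPhi_t * (W (j VPhi_s) / j VPhi_s)
     + ((real n + 1) * \<gamma> - real n - 3) * ((j VPhi_t)\<^sup>2 / 2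
         - \<gamma> * S (j VS) / (\<gamma> - 1) * P (j VPhi) * W (j VPhi_s))
     + q * S (j VS) * (j VPhi * P (j VPhi)) * (W (j VPhi_s) / j VPhi_s)"
proof -
  \<comment> \<open>For \<open>n = 0\<close> both sides equal \<open>phi\<close>, whatever its
    sign.\<close>
  have "j VPhi ^ (n + 1) * (j VPhi ^ n) powr (- \<gamma>) = j VPhi * P (j VPhi)"
    using J_D[OF assms] unfolding P_def
    by (auto simp: powr_diff powr_minus divide_simps)
  then show ?thesis
    using J_D[OF assms] unfolding T2_s_def by (simp add: powr_minus_gamma P_def W_def)
qed

lemma current_Z2:
  assumes "j \<in> J"
  shows "current_t (lagrangian n \<gamma> S) (Z2 n \<gamma> q) j = T2_t n \<gamma> q S j"
    and "current_s (lagrangian n \<gamma> S) (Z2 n \<gamma> q) j = T2_s n \<gamma> q S j"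
proof -
  have X: "lift (xi_t (Z2 n \<gamma> q)) j = 2 * q * j VT"
    "lift (xi_s (Z2 n \<gamma> q)) j = (real n + 1) * \<gamma> - real n - 3"
    "lift (eta (Z2 n \<gamma> q)) j = q * j VPhi"
    by (simp_all add: lift_def base_def xi_t_def xi_s_def eta_def Z2_def)
  show "current_t (lagrangian n \<gamma> S) (Z2 n \<gamma> q) j = T2_t n \<gamma> q S j"
    unfolding current_t_def T2_t_eq X pd_lagrangian[OF assms] unfolding lagrangian_eq
    by (simp add: field_simps power2_eq_square)
  show "current_s (lagrangian n \<gamma> S) (Z2 n \<gamma> q) j = T2_s n \<gamma> q S j"
    unfolding current_s_def T2_s_eq[OF assms] X pd_lagrangian[OF assms] unfolding lagrangian_eq
    using J_D[OF assms] \<gamma> by (simp add: field_simps power2_eq_square)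
qed

text \<open>Direct evaluation of the divergence: \<open>phi_ts\<close> drops out because
  \<open>T4\<close> and \<open>G3\<close> are opposite, and \<open>phi_tt\<close> is eliminated with
  the gas equation.\<close>

lemma T2_conserved:
  assumes "j \<in> J" "gas_eq n \<gamma> S j = 0"
  shows "Dt (T2_t n \<gamma> q S) j + Ds (T2_s n \<gamma> q S) j = 0"
proof -
  define \<kappa> where "\<kappa> = (real n + 1) * \<gamma> - real n - 3"
  define T where "T = (\<lambda>j. - 2 * q * j VT * ((j VPhi_t)\<^sup>2 / 2
         + S (j VS) / (\<gamma> - 1) * P (j VPhi) * W (j VPhi_s))
     - \<kappa> * j VPhi_s * j VPhi_t + q * j VPhi * j VPhi_t)"
  define G where "G = (\<lambda>j. - 2 * q * j VT * S (j VS) * P (j VPhi) * j VPhi_t * (W (j VPhi_s) / j VPhi_s)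
     + \<kappa> * ((j VPhi_t)\<^sup>2 / 2 - \<gamma> * S (j VS) / (\<gamma> - 1) * P (j VPhi) * W (j VPhi_s))
     + q * S (j VS) * (j VPhi * P (j VPhi)) * (W (j VPhi_s) / j VPhi_s))"
  \<comment> \<open>Absorbs the division by \<open>\<gamma> - 1\<close>: both \<open>c\<close> and
    \<open>S = c (\<gamma> - 1)\<close> occur in the current.\<close>
  define c where "c = S (j VS) / (\<gamma> - 1)"
  define V where "V = W (j VPhi_s) / j VPhi_s"
  have S: "S (j VS) = c * (\<gamma> - 1)"
    using gamma_minus_one by (simp add: c_def)
  have W: "W (j VPhi_s) = V * j VPhi_s"
    using J_D[OF assms(1)] by (simp add: V_def)
  have T1: "pd VT T j = - 2 * q * ((j VPhi_t)\<^sup>2 / 2 + c * P (j VPhi) * (V * j VPhi_s))"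
    unfolding T_def c_def V_def
    by (insert J_D[OF assms(1)] gamma_minus_one, rule pd_eqI', simp only: coord_upd, (rule gas_DERIV derivative_eq_intros refl | assumption)+,
      (simp add: field_simps)?)
  have T2: "pd VPhi T j = 2 * q * j VT * S (j VS) * R (j VPhi) * P (j VPhi) * (V * j VPhi_s) + q * j VPhi_t"
    unfolding T_def V_def
    by (insert J_D[OF assms(1)] gamma_minus_one, rule pd_eqI', simp only: coord_upd, (rule gas_DERIV derivative_eq_intros refl | assumption)+,
      (simp add: field_simps)?)
  have T3: "pd VPhi_t T j = - 2 * q * j VT * j VPhi_t - \<kappa> * j VPhi_s + q * j VPhi"
    unfolding T_def 
    by (insert J_D[OF assms(1)] gamma_minus_one, rule pd_eqI', simp only: coord_upd, (rule gas_DERIV derivative_eq_intros refl | assumption)+,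
      (simp add: field_simps)?)
  have T4: "pd VPhi_s T j = 2 * q * j VT * S (j VS) * P (j VPhi) * V - \<kappa> * j VPhi_t"
    unfolding T_def V_def
    by (insert J_D[OF assms(1)] gamma_minus_one, rule pd_eqI', simp only: coord_upd, (rule gas_DERIV derivative_eq_intros refl | assumption)+,
      (simp add: field_simps)?)
  have G1: "pd VS G j = q * (- 2 * q * j VT * S (j VS) * P (j VPhi) * j VPhi_t * V
      - \<kappa> * \<gamma> * c * P (j VPhi) * (V * j VPhi_s) + q * S (j VS) * j VPhi * P (j VPhi) * V)"
    unfolding G_def V_def c_def
    by (insert J_D[OF assms(1)] gamma_minus_one, rule pd_eqI', simp only: coord_upd, (rule gas_DERIV derivative_eq_intros refl | assumption)+,
      (simp add: field_simps)?)
  have G2: "pd VPhi G j = - 2 * q * j VT * S (j VS) * (1 - \<gamma>) * R (j VPhi) * P (j VPhi) * j VPhi_t * V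
      + \<kappa> * \<gamma> * S (j VS) * R (j VPhi) * P (j VPhi) * (V * j VPhi_s)
      + q * S (j VS) * (1 + (1 - \<gamma>) * (R (j VPhi) * j VPhi)) * P (j VPhi) * V"
    unfolding G_def V_def
    by (insert J_D[OF assms(1)] gamma_minus_one, rule pd_eqI', simp only: coord_upd, (rule gas_DERIV derivative_eq_intros refl | assumption)+,
      (simp add: field_simps)?)
  have G3: "pd VPhi_t G j = - 2 * q * j VT * S (j VS) * P (j VPhi) * V + \<kappa> * j VPhi_t"
    unfolding G_def V_def
    by (insert J_D[OF assms(1)] gamma_minus_one, rule pd_eqI', simp only: coord_upd, (rule gas_DERIV derivative_eq_intros refl | assumption)+,
      (simp add: field_simps)?)
  have G4: "pd VPhi_s G j = - \<gamma> * (V / j VPhi_s) * (- 2 * q * j VT * S (j VS) * P (j VPhi) * j VPhi_t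
        + q * S (j VS) * j VPhi * P (j VPhi))
      + \<kappa> * \<gamma> * S (j VS) * P (j VPhi) * V"
    unfolding G_def V_def
    by (insert J_D[OF assms(1)] gamma_minus_one, rule pd_eqI', simp only: coord_upd, (rule gas_DERIV derivative_eq_intros refl | assumption)+,
      (simp add: field_simps)?)
  \<comment> \<open>With the ratio \<open>y\<close>, the quotient \<open>V\<close> and
    \<open>n\<close> written as \<open>R phi\<close>, no division by a jet coordinate is left, and
    the claim becomes a polynomial identity in independent symbols.\<close>
  define y where "y = j VPhi_ss / j VPhi_s"
  have n: "real n = R (j VPhi) * j VPhi"
    using J_D[OF assms(1)] by (auto simp: R_def)
  have tt: "j VPhi_tt = - (P (j VPhi) * V * S (j VS)
      * (q - \<gamma> * R (j VPhi) * j VPhi_s - \<gamma> * y))"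
    using assms gas_eq_eq by (simp add: V_def y_def)
  have ss: "j VPhi_ss * pd VPhi_s G j
      = - \<gamma> * V * y * (- 2 * q * j VT * S (j VS) * P (j VPhi) * j VPhi_t
        + q * S (j VS) * j VPhi * P (j VPhi))
      + y * j VPhi_s * (\<kappa> * \<gamma> * S (j VS) * P (j VPhi) * V)"
    using J_D[OF assms(1)] unfolding G4 y_def by (simp add: field_simps)
  have DT: "Dt (T2_t n \<gamma> q S) j = Dt T j"
    unfolding T2_t_eq T_def \<kappa>_def ..
  have DG: "Ds (T2_s n \<gamma> q S) j = Ds G j"
    unfolding G_def \<kappa>_def by (rule Ds_cong[OF open_gas_dom T2_s_eq assms(1)])
  show ?thesis
    unfolding DT DG unfolding Dt_def Ds_def ss tt T1 T2 T3 T4 G1 G2 G3 S \<kappa>_def n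
    by (simp add: algebra_simps power2_eq_square)
qed

end

section \<open>Quadratic vector fields are Noether symmetries\<close>

text \<open>The parameters are those of time translation (\<open>a0\<close>), scaling
  (\<open>a1\<close>), the projective time change (\<open>a2\<close>), the shift of \<open>s\<close>
  (\<open>b\<close>), translation of \<open>phi\<close> (\<open>c0\<close>) and the Galilean boost
  (\<open>c1\<close>). The factor 2 makes the \<open>phi\<close>-derivative of the last component,
  \<open>a1 + a2 t\<close>, half the \<open>t\<close>-derivative of the first.\<close>

definition quad_field ::
    "real \<Rightarrow> real \<Rightarrow> real \<Rightarrow> real \<Rightarrow> real \<Rightarrow> real \<Rightarrow> vfield" where
  "quad_field a0 a1 a2 b c0 c1 =
    (\<lambda>(t, s, \<phi>). (a0 + 2 * a1 * t + a2 * t\<^sup>2, b, (a1 + a2 * t) * \<phi> + c0 + c1 * t))"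

lemma Cinf_on_point_polynomials:
  fixes \<Omega> :: "point set"
  assumes "open \<Omega>"
  shows "Cinf_on \<Omega> (\<lambda>p. a0 + 2 * a1 * fst p + a2 * (fst p)\<^sup>2)"
    and "Cinf_on \<Omega> (\<lambda>p. (a1 + a2 * fst p) * snd (snd p) + c0 + c1 * fst p)"
    and "Cinf_on \<Omega> (\<lambda>p. a2 * (snd (snd p))\<^sup>2 / 2 + c1 * snd (snd p))"
proof -
  have [intro]: "Cinf_on \<Omega> (\<lambda>p. fst p)" "Cinf_on \<Omega> (\<lambda>p. snd (snd p))"
    by (auto intro!: Cinf_on_linear bounded_linear_intros)
  note rules = Cinf_on_add[OF assms] Cinf_on_mult[OF assms] Cinf_on_const
  show "Cinf_on \<Omega> (\<lambda>p. a0 + 2 * a1 * fst p + a2 * (fst p)\<^sup>2)"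
    unfolding power2_eq_square by (intro rules) auto
  show "Cinf_on \<Omega> (\<lambda>p. (a1 + a2 * fst p) * snd (snd p) + c0 + c1 * fst p)"
    by (intro rules) auto
  have "Cinf_on \<Omega> (\<lambda>p. (a2 / 2) * (snd (snd p) * snd (snd p)) + c1 * snd (snd p))"
    by (intro rules) auto
  then show "Cinf_on \<Omega> (\<lambda>p. a2 * (snd (snd p))\<^sup>2 / 2 + c1 * snd (snd p))"
    by (simp add: power2_eq_square)
qed

text \<open>\<open>X\<close> is tied to the normal form on \<Omega> only, as in
  \<open>span_on\<close>; its derivatives are therefore transferred by congruence over the open set
  of jets.\<close>

locale quadratic_on =
  fixes \<Omega> :: "point set" and X :: vfield and a0 a1 a2 b c0 c1 :: real
  assumes open_dom: "open \<Omega>"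
    and quad: "\<And>p. p \<in> \<Omega> \<Longrightarrow> X p = quad_field a0 a1 a2 b c0 c1 p"
begin

lemma Cinf_vfield: "Cinf_vfield_on \<Omega> X"
  unfolding Cinf_vfield_on_def
proof (intro conjI)
  show "Cinf_on \<Omega> (xi_t X)"
    by (rule Cinf_on_cong[OF open_dom _ Cinf_on_point_polynomials(1)[OF open_dom]])
      (simp add: quad quad_field_def xi_t_def split_beta)
  show "Cinf_on \<Omega> (xi_s X)"
    by (rule Cinf_on_cong[OF open_dom _ Cinf_on_const[of _ b]])
      (simp add: quad quad_field_def xi_s_def split_beta)
  show "Cinf_on \<Omega> (eta X)"
    by (rule Cinf_on_cong[OF open_dom _ Cinf_on_point_polynomials(2)[OF open_dom]])
      (simp add: quad quad_field_def eta_def split_beta)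
qed

lemma lift_X:
  assumes "j \<in> jets_over \<Omega>"
  shows "lift (xi_t X) j = a0 + 2 * a1 * j VT + a2 * (j VT)\<^sup>2"
    and "lift (xi_s X) j = b"
    and "lift (eta X) j = (a1 + a2 * j VT) * j VPhi + c0 + c1 * j VT"
  using assms
  by (auto simp: jets_over_def lift_def xi_t_def xi_s_def eta_def quad quad_field_def base_def)

lemma D_xi_t:
  assumes "j \<in> jets_over \<Omega>"
  shows "Dt (lift (xi_t X)) j = 2 * (a1 + a2 * j VT)" and "Ds (lift (xi_t X)) j = 0"
proof -
  let ?F = "\<lambda>j. a0 + 2 * a1 * j VT + a2 * (j VT)\<^sup>2"
  have eqs: "Dt (lift (xi_t X)) j = Dt ?F j" "Ds (lift (xi_t X)) j = Ds ?F j"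
    by (rule Dt_cong[OF open_dom lift_X(1) assms] Ds_cong[OF open_dom lift_X(1) assms]; assumption)+
  have "pd VT ?F j = 2 * (a1 + a2 * j VT)" "pd VS ?F j = 0" "pd VPhi ?F j = 0"
    "pd VPhi_t ?F j = 0" "pd VPhi_s ?F j = 0"
    by (rule pd_eqI, auto intro!: derivative_eq_intros)+
  then show "Dt (lift (xi_t X)) j = 2 * (a1 + a2 * j VT)" "Ds (lift (xi_t X)) j = 0"
    unfolding eqs by (simp_all add: Dt_def Ds_def)
qed

lemma D_xi_s:
  assumes "j \<in> jets_over \<Omega>"
  shows "Dt (lift (xi_s X)) j = 0" and "Ds (lift (xi_s X)) j = 0"
proof -
  have eqs: "Dt (lift (xi_s X)) j = Dt (\<lambda>_. b) j" "Ds (lift (xi_s X)) j = Ds (\<lambda>_. b) j"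
    by (rule Dt_cong[OF open_dom lift_X(2) assms] Ds_cong[OF open_dom lift_X(2) assms]; assumption)+
  show "Dt (lift (xi_s X)) j = 0" "Ds (lift (xi_s X)) j = 0"
    unfolding eqs by (simp_all add: Dt_def Ds_def pd_def)
qed

lemma D_eta:
  assumes "j \<in> jets_over \<Omega>"
  shows "Dt (lift (eta X)) j = a2 * j VPhi + c1 + j VPhi_t * (a1 + a2 * j VT)"
    and "Ds (lift (eta X)) j = j VPhi_s * (a1 + a2 * j VT)"
proof -
  let ?F = "\<lambda>j. (a1 + a2 * j VT) * j VPhi + c0 + c1 * j VT"
  have eqs: "Dt (lift (eta X)) j = Dt ?F j" "Ds (lift (eta X)) j = Ds ?F j"
    by (rule Dt_cong[OF open_dom lift_X(3) assms] Ds_cong[OF open_dom lift_X(3) assms]; assumption)+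
  have "pd VT ?F j = a2 * j VPhi + c1" "pd VS ?F j = 0" "pd VPhi ?F j = a1 + a2 * j VT"
    "pd VPhi_t ?F j = 0" "pd VPhi_s ?F j = 0"
    by (rule pd_eqI, auto intro!: derivative_eq_intros)+
  then show "Dt (lift (eta X)) j = a2 * j VPhi + c1 + j VPhi_t * (a1 + a2 * j VT)"
    "Ds (lift (eta X)) j = j VPhi_s * (a1 + a2 * j VT)"
    unfolding eqs by (simp_all add: Dt_def Ds_def)
qed

lemma eta_t_X:
  assumes "j \<in> jets_over \<Omega>"
  shows "eta_t X j = a2 * j VPhi + c1 - j VPhi_t * (a1 + a2 * j VT)"
  unfolding eta_t_def D_xi_t[OF assms] D_xi_s[OF assms] D_eta[OF assms]
  by (simp add: algebra_simps)

lemma eta_s_X: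
  assumes "j \<in> jets_over \<Omega>"
  shows "eta_s X j = j VPhi_s * (a1 + a2 * j VT)"
  unfolding eta_s_def D_xi_t[OF assms] D_xi_s[OF assms] D_eta[OF assms] by simp

text \<open>The two terms \<open>a2 phi_t\<close>, from differentiating \<open>phi\<close> and the
  coefficient \<open>a1 + a2 t\<close>, cancel; of the factor 3, one unit comes from
  \<open>eta_t\<close> and two from the \<open>t\<close>-derivative of \<open>xi_t\<close>.\<close>

lemma eta_tt_X:
  assumes "j \<in> jets_over \<Omega>"
  shows "eta_tt X j = - 3 * (a1 + a2 * j VT) * j VPhi_tt"
proof -
  let ?F = "\<lambda>j. a2 * j VPhi + c1 - j VPhi_t * (a1 + a2 * j VT)"
  have eq: "Dt (eta_t X) j = Dt ?F j"
    by (rule Dt_cong[OF open_dom eta_t_X assms])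
  have "pd VT ?F j = - (a2 * j VPhi_t)" "pd VPhi ?F j = a2"
    "pd VPhi_t ?F j = - (a1 + a2 * j VT)" "pd VPhi_s ?F j = 0"
    by (rule pd_eqI, auto intro!: derivative_eq_intros)+
  then show ?thesis
    unfolding eta_tt_def D_xi_t[OF assms] D_xi_s[OF assms] eq
    by (simp add: Dt_def) (simp add: algebra_simps)
qed

lemma eta_ss_X:
  assumes "j \<in> jets_over \<Omega>"
  shows "eta_ss X j = (a1 + a2 * j VT) * j VPhi_ss"
proof -
  let ?F = "\<lambda>j. j VPhi_s * (a1 + a2 * j VT)"
  have eq: "Ds (eta_s X) j = Ds ?F j"
    by (rule Ds_cong[OF open_dom eta_s_X assms])
  have "pd VS ?F j = 0" "pd VPhi ?F j = 0"
    "pd VPhi_t ?F j = 0" "pd VPhi_s ?F j = a1 + a2 * j VT"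
    by (rule pd_eqI, auto intro!: derivative_eq_intros)+
  then show ?thesis
    unfolding eta_ss_def D_xi_t[OF assms] D_xi_s[OF assms] eq
    by (simp add: Ds_def)
qed

end

context exponential_gas
begin

definition "\<kappa> = (real n + 1) * \<gamma> - real n - 3"

text \<open>The potential terms cancel by the relation between \<open>b\<close> and
  \<open>a1\<close>, and the kinetic terms quadratic in \<open>phi_t\<close> cancel among
  themselves. Only the explicit time dependence of \<open>eta\<close> survives.\<close>

lemma noether_lhs_quadratic:
  assumes "quadratic_on \<Omega> X a0 a1 a2 b c0 c1" "\<Omega> \<subseteq> gas_dom n"
    and "q * b = a1 * \<kappa>" "a2 * \<kappa> = 0" "n \<noteq> 0 \<Longrightarrow> c0 = 0 \<and> c1 = 0"
    and "j \<in> jets_over \<Omega>"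
  shows "noether_lhs (lagrangian n \<gamma> S) X j = j VPhi_t * (a2 * j VPhi + c1)"
proof -
  interpret quadratic_on \<Omega> X a0 a1 a2 b c0 c1 by fact
  have j: "j \<in> J"
    using jets_over_mono[OF assms(2)] assms(6) by blast
  define m c where "m = a1 + a2 * j VT" and "c = S (j VS) / (\<gamma> - 1)"
  have S: "S (j VS) = c * (\<gamma> - 1)"
    using gamma_minus_one by (simp add: c_def)
  \<comment> \<open>The time-dependent part of \<open>m\<close> is annihilated by \<kappa>, so the
    constant \<open>b\<close> can balance it at every \<open>t\<close>.\<close>
  have "m * \<kappa> = a1 * \<kappa> + j VT * (a2 * \<kappa>)"
    by (simp add: m_def algebra_simps)
  then have m: "q * b = m * \<kappa>"
    using assms(3,4) by auto
  define h where "h = m * j VPhi + c0 + c1 * j VT"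
  \<comment> \<open>For positive \<open>n\<close>, \<open>h\<close> is \<open>m phi\<close>, which
    cancels the denominator of \<open>R\<close>; for \<open>n = 0\<close> both sides vanish.\<close>
  have "h * R (j VPhi) = m * real n"
    unfolding R_def using assms(5) J_D[OF j] by (cases "n = 0") (auto simp: h_def)
  then have phi: "h * (R (j VPhi) * S (j VS) * P (j VPhi) * W (j VPhi_s))
      = m * real n * S (j VS) * P (j VPhi) * W (j VPhi_s)"
    by (metis mult.assoc)
  have s: "b * - (q * S (j VS) * P (j VPhi) * W (j VPhi_s) / (\<gamma> - 1))
      = - (q * b) * c * P (j VPhi) * W (j VPhi_s)"
    by (simp add: c_def)
  have phi_s: "j VPhi_s * m * (S (j VS) * P (j VPhi) * W (j VPhi_s) / j VPhi_s)
      = m * S (j VS) * P (j VPhi) * W (j VPhi_s)"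
    using J_D[OF j] by simp
  have "noether_lhs (lagrangian n \<gamma> S) X j
      = - (q * b) * c * P (j VPhi) * W (j VPhi_s)
        + m * real n * S (j VS) * P (j VPhi) * W (j VPhi_s)
        + (a2 * j VPhi + c1 - j VPhi_t * m) * j VPhi_t
        + m * S (j VS) * P (j VPhi) * W (j VPhi_s)
        + ((j VPhi_t)\<^sup>2 / 2 - c * P (j VPhi) * W (j VPhi_s)) * (2 * m)"
    unfolding noether_lhs_def pr1_def lift_X[OF assms(6)] D_xi_t[OF assms(6)] D_xi_s[OF assms(6)]
      eta_t_X[OF assms(6)] eta_s_X[OF assms(6)] pd_lagrangian[OF j]
    unfolding m_def[symmetric] h_def[symmetric] s phi phi_s
    unfolding lagrangian_eq c_def[symmetric] by simp
  then show ?thesis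
    unfolding m S \<kappa>_def by (simp add: field_simps power2_eq_square)
qed

section \<open>Second prolongation and invariance of the gas equation\<close>

lemma pd_gas_eq:
  assumes "j \<in> J"
  defines "y \<equiv> j VPhi_ss / j VPhi_s" and "V \<equiv> W (j VPhi_s) / j VPhi_s"
  defines "B \<equiv> q - \<gamma> * R (j VPhi) * j VPhi_s - \<gamma> * y"
  shows "pd VT (gas_eq n \<gamma> S) j = 0"
    and "pd VS (gas_eq n \<gamma> S) j = q * (P (j VPhi) * V * S (j VS) * B)"
    and "pd VPhi (gas_eq n \<gamma> S) j = P (j VPhi) * V * S (j VS) *
      ((1 - \<gamma>) * R (j VPhi) * B + \<gamma> * (R (j VPhi) / j VPhi) * j VPhi_s)"
    and "pd VPhi_t (gas_eq n \<gamma> S) j = 0"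
    and "pd VPhi_s (gas_eq n \<gamma> S) j = P (j VPhi) * V * S (j VS) *
      (- \<gamma> * B / j VPhi_s - \<gamma> * R (j VPhi) + \<gamma> * y / j VPhi_s)"
    and "pd VPhi_tt (gas_eq n \<gamma> S) j = 1"
    and "pd VPhi_ts (gas_eq n \<gamma> S) j = 0"
    and "pd VPhi_ss (gas_eq n \<gamma> S) j = - (P (j VPhi) * V * S (j VS) * \<gamma> / j VPhi_s)"
proof -
  have eq: "pd c (gas_eq n \<gamma> S) j = pd c (\<lambda>j. j VPhi_tt + P (j VPhi) * (W (j VPhi_s) / j VPhi_s)
     * S (j VS) * (q - \<gamma> * R (j VPhi) * j VPhi_s - \<gamma> * (j VPhi_ss / j VPhi_s))) j" for c
    by (rule pd_cong[OF open_gas_dom gas_eq_eq assms(1)])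
  show "pd VT (gas_eq n \<gamma> S) j = 0"
    unfolding eq y_def V_def B_def
    by (insert J_D[OF assms(1)], rule pd_eqI', simp only: coord_upd,
      (rule gas_DERIV derivative_eq_intros refl | assumption)+, (simp add: field_simps)?)
  show "pd VS (gas_eq n \<gamma> S) j = q * (P (j VPhi) * V * S (j VS) * B)"
    unfolding eq y_def V_def B_def
    by (insert J_D[OF assms(1)], rule pd_eqI', simp only: coord_upd,
      (rule gas_DERIV derivative_eq_intros refl | assumption)+, (simp add: field_simps)?)
  show "pd VPhi (gas_eq n \<gamma> S) j = P (j VPhi) * V * S (j VS) *
      ((1 - \<gamma>) * R (j VPhi) * B + \<gamma> * (R (j VPhi) / j VPhi) * j VPhi_s)"
    unfolding eq y_def V_def B_def
    by (insert J_D[OF assms(1)], rule pd_eqI', simp only: coord_upd,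
      (rule gas_DERIV derivative_eq_intros refl | assumption)+, (simp add: field_simps)?)
  show "pd VPhi_t (gas_eq n \<gamma> S) j = 0"
    unfolding eq y_def V_def B_def
    by (insert J_D[OF assms(1)], rule pd_eqI', simp only: coord_upd,
      (rule gas_DERIV derivative_eq_intros refl | assumption)+, (simp add: field_simps)?)
  show "pd VPhi_s (gas_eq n \<gamma> S) j = P (j VPhi) * V * S (j VS) *
      (- \<gamma> * B / j VPhi_s - \<gamma> * R (j VPhi) + \<gamma> * y / j VPhi_s)"
    unfolding eq y_def V_def B_def
    by (insert J_D[OF assms(1)], rule pd_eqI', simp only: coord_upd,
      (rule gas_DERIV derivative_eq_intros refl | assumption)+, (simp add: field_simps)?)
  show "pd VPhi_tt (gas_eq n \<gamma> S) j = 1"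
    unfolding eq y_def V_def B_def
    by (insert J_D[OF assms(1)], rule pd_eqI', simp only: coord_upd,
      (rule gas_DERIV derivative_eq_intros refl | assumption)+, (simp add: field_simps)?)
  show "pd VPhi_ts (gas_eq n \<gamma> S) j = 0"
    unfolding eq y_def V_def B_def
    by (insert J_D[OF assms(1)], rule pd_eqI', simp only: coord_upd,
      (rule gas_DERIV derivative_eq_intros refl | assumption)+, (simp add: field_simps)?)
  show "pd VPhi_ss (gas_eq n \<gamma> S) j = - (P (j VPhi) * V * S (j VS) * \<gamma> / j VPhi_s)"
    unfolding eq y_def V_def B_def
    by (insert J_D[OF assms(1)], rule pd_eqI', simp only: coord_upd,
      (rule gas_DERIV derivative_eq_intros refl | assumption)+, (simp add: field_simps)?)
qed

text \<open>Outside the bracket \<open>B\<close> the terms in \<open>R phi_s\<close> and in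
  \<open>y\<close> cancel. Once the equation replaces \<open>phi_tt\<close>, everything is a
  multiple of \<open>B\<close> with factor \<open>q * b - m * \<kappa>\<close>, the same combination
  as in the Noether condition.\<close>

lemma pr2_gas_eq_quadratic:
  assumes "quadratic_on \<Omega> X a0 a1 a2 b c0 c1" "\<Omega> \<subseteq> gas_dom n"
    and "q * b = a1 * \<kappa>" "a2 * \<kappa> = 0" "n \<noteq> 0 \<Longrightarrow> c0 = 0 \<and> c1 = 0"
    and "j \<in> jets_over \<Omega>" "gas_eq n \<gamma> S j = 0"
  shows "pr2 X (gas_eq n \<gamma> S) j = 0"
proof -
  interpret quadratic_on \<Omega> X a0 a1 a2 b c0 c1 by fact
  have j: "j \<in> J"
    using jets_over_mono[OF assms(2)] assms(6) by blast
  define m where "m = a1 + a2 * j VT"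
  define y where "y = j VPhi_ss / j VPhi_s"
  define V where "V = W (j VPhi_s) / j VPhi_s"
  define B where "B = q - \<gamma> * R (j VPhi) * j VPhi_s - \<gamma> * y"
  define h where "h = m * j VPhi + c0 + c1 * j VT"
  have "m * \<kappa> = a1 * \<kappa> + j VT * (a2 * \<kappa>)"
    by (simp add: m_def algebra_simps)
  then have m: "q * b = m * \<kappa>"
    using assms(3,4) by auto
  have R: "h * R (j VPhi) = m * real n" "h * (R (j VPhi) / j VPhi) = m * R (j VPhi)"
    unfolding R_def using assms(5) J_D[OF j] by (cases "n = 0"; auto simp: h_def)+
  have tt: "j VPhi_tt = - (P (j VPhi) * V * S (j VS) * B)"
    using assms(7) gas_eq_eq[OF j] by (simp add: V_def y_def B_def)
  have phi: "h * (P (j VPhi) * V * S (j VS) *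
      ((1 - \<gamma>) * R (j VPhi) * B + \<gamma> * (R (j VPhi) / j VPhi) * j VPhi_s))
    = P (j VPhi) * V * S (j VS) * ((1 - \<gamma>) * (h * R (j VPhi)) * B
      + \<gamma> * (h * (R (j VPhi) / j VPhi)) * j VPhi_s)"
    by (simp add: algebra_simps)
  have phi_s: "j VPhi_s * m * (P (j VPhi) * V * S (j VS) *
      (- \<gamma> * B / j VPhi_s - \<gamma> * R (j VPhi) + \<gamma> * y / j VPhi_s))
    = m * P (j VPhi) * V * S (j VS) * (- \<gamma> * B - \<gamma> * R (j VPhi) * j VPhi_s + \<gamma> * y)"
    using J_D[OF j] by (simp add: field_simps)
  have phi_ss: "m * j VPhi_ss * - (P (j VPhi) * V * S (j VS) * \<gamma> / j VPhi_s)
    = - m * P (j VPhi) * V * S (j VS) * \<gamma> * y"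
    by (simp add: y_def)
  have "pr2 X (gas_eq n \<gamma> S) j = b * (q * (P (j VPhi) * V * S (j VS) * B))
      + P (j VPhi) * V * S (j VS) * ((1 - \<gamma>) * (m * real n) * B + \<gamma> * (m * R (j VPhi)) * j VPhi_s)
      + m * P (j VPhi) * V * S (j VS) * (- \<gamma> * B - \<gamma> * R (j VPhi) * j VPhi_s + \<gamma> * y)
      - 3 * m * j VPhi_tt - m * P (j VPhi) * V * S (j VS) * \<gamma> * y"
    unfolding pr2_def pr1_def lift_X[OF assms(6)] eta_t_X[OF assms(6)] eta_s_X[OF assms(6)]
      eta_tt_X[OF assms(6)] eta_ss_X[OF assms(6)] pd_gas_eq[OF j]
      m_def[symmetric] h_def[symmetric] y_def[symmetric] V_def[symmetric] 
    unfolding B_def[symmetric] phi phi_s phi_ss R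
    by simp
  also have "\<dots> = P (j VPhi) * V * S (j VS) * B * (q * b - m * \<kappa>)"
    unfolding tt \<kappa>_def by (simp add: algebra_simps)
  finally show ?thesis by (simp add: m)
qed

lemma quadratic_symmetries:
  assumes "quadratic_on \<Omega> X a0 a1 a2 b c0 c1" "\<Omega> \<subseteq> gas_dom n"
    and "q * b = a1 * \<kappa>" "a2 * \<kappa> = 0" "n \<noteq> 0 \<Longrightarrow> c0 = 0 \<and> c1 = 0"
  shows "point_symmetry \<Omega> (gas_eq n \<gamma> S) X" and "noether_symmetry \<Omega> (lagrangian n \<gamma> S) X"
proof -
  interpret quadratic_on \<Omega> X a0 a1 a2 b c0 c1 by fact
  show "point_symmetry \<Omega> (gas_eq n \<gamma> S) X"
    unfolding point_symmetry_def using Cinf_vfield pr2_gas_eq_quadratic[OF assms] by blast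
  \<comment> \<open>The \<open>phi\<close>-antiderivative of \<open>a2 phi + c1\<close>, so that its
    total \<open>t\<close>-derivative is the remaining term; \<open>B2\<close> can then be
    0.\<close>
  let ?B1 = "\<lambda>p :: point. a2 * (snd (snd p))\<^sup>2 / 2 + c1 * snd (snd p)"
  have "Dt (lift ?B1) j = j VPhi_t * (a2 * j VPhi + c1)" for j
  proof -
    have eq: "lift ?B1 = (\<lambda>j. a2 * (j VPhi)\<^sup>2 / 2 + c1 * j VPhi)"
      by (simp add: fun_eq_iff lift_def base_def)
    have "pd VT (lift ?B1) j = 0" "pd VPhi (lift ?B1) j = a2 * j VPhi + c1"
      "pd VPhi_t (lift ?B1) j = 0" "pd VPhi_s (lift ?B1) j = 0"
      unfolding eq by (rule pd_eqI, auto intro!: derivative_eq_intros)+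
    then show ?thesis by (simp add: Dt_def)
  qed
  moreover have "Ds (lift (\<lambda>_. 0)) j = 0" for j
    by (simp add: Ds_def lift_def pd_def)
  ultimately have "\<forall>j\<in>jets_over \<Omega>.
      noether_lhs (lagrangian n \<gamma> S) X j = Dt (lift ?B1) j + Ds (lift (\<lambda>_. 0)) j"
    using noether_lhs_quadratic[OF assms] by simp
  then show "noether_symmetry \<Omega> (lagrangian n \<gamma> S) X"
    unfolding noether_symmetry_def
    using Cinf_vfield Cinf_on_point_polynomials(3)[OF open_dom] Cinf_on_const by blast
qed

text \<open>Here \<open>a2 = c1 = 0\<close>, so the divergence term disappears.\<close>

lemma variational_symmetry_Z2:
  "variational_symmetry (gas_dom n) (lagrangian n \<gamma> S) (Z2 n \<gamma> q)"
proof -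
  interpret quadratic_on "gas_dom n" "Z2 n \<gamma> q" 0 q 0 \<kappa> 0 0
    by unfold_locales (auto simp: open_gas_dom Z2_def quad_field_def \<kappa>_def)
  show ?thesis
    unfolding variational_symmetry_def
    using Cinf_vfield noether_lhs_quadratic[OF quadratic_on_axioms] by simp
qed

end

section \<open>The determining equations and their solution\<close>

lemma cubic_coefficients_zero:
  fixes \<alpha> \<beta> \<delta> \<epsilon> :: real
  assumes "\<And>v. \<alpha> + \<beta> * v + \<delta> * v\<^sup>2 + \<epsilon> * v ^ 3 = 0"
  shows "\<alpha> = 0" "\<beta> = 0" "\<delta> = 0" "\<epsilon> = 0"
  using assms[of 0] assms[of 1] assms[of "- 1"] assms[of 2] by (simp_all add: power3_eq_cube)

context exponential_gas
begin

text \<open>Growth at infinity separates the terms: after division by \<open>w\<close> only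
  \<open>B\<close> survives in the limit, then only \<open>A\<close>, since \<open>W\<close> tends
  to 0. What remains is \<open>W w * (C / w + D)\<close> with \<open>W\<close> positive, and two
  values of \<open>w\<close> suffice.\<close>

lemma W_coefficients_zero:
  assumes eq: "\<And>w. w > 0 \<Longrightarrow> A + B * w + C * (W w / w) + D * W w = 0"
  shows "A = 0" "B = 0" "C = 0" "D = 0"
proof -
  have W: "(W \<longlongrightarrow> 0) at_top"
    unfolding W_def using \<gamma> by (intro tendsto_neg_powr filterlim_ident) auto
  have inv: "((\<lambda>w::real. 1 / w) \<longlongrightarrow> 0) at_top"
    by (intro tendsto_divide_0[OF tendsto_const] filterlim_at_top_imp_at_infinity filterlim_ident)
  have Winv: "((\<lambda>w. W w * (1 / w)) \<longlongrightarrow> 0) at_top"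
    using tendsto_mult[OF W inv] by simp
  have "((\<lambda>w. A * (1 / w) + B + C * (W w * (1 / w) * (1 / w)) + D * (W w * (1 / w)))
      \<longlongrightarrow> A * 0 + B + C * (0 * 0) + D * 0) at_top"
    by (intro tendsto_intros inv Winv)
  moreover have "\<forall>\<^sub>F w in at_top.
      A * (1 / w) + B + C * (W w * (1 / w) * (1 / w)) + D * (W w * (1 / w)) = 0"
    using eventually_gt_at_top[of 0]
  proof eventually_elim
    case (elim w)
    have "A * (1 / w) + B + C * (W w * (1 / w) * (1 / w)) + D * (W w * (1 / w))
        = (A + B * w + C * (W w / w) + D * W w) / w"
      using elim by (simp add: field_simps)
    then show ?case using eq[OF elim] by simp
  qed
  ultimately have "((\<lambda>_. 0) \<longlongrightarrow> B) (at_top :: real filter)"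
    using tendsto_cong by force
  then show B: "B = 0"
    by (simp add: tendsto_const_iff)
  have "((\<lambda>w. A + C * (W w * (1 / w)) + D * W w) \<longlongrightarrow> A + C * 0 + D * 0) at_top"
    by (intro tendsto_intros W Winv)
  moreover have "\<forall>\<^sub>F w in at_top. A + C * (W w * (1 / w)) + D * W w = 0"
    using eventually_gt_at_top[of 0]
    by eventually_elim (use eq in \<open>simp add: B\<close>)
  ultimately have "((\<lambda>_. 0) \<longlongrightarrow> A) (at_top :: real filter)"
    using tendsto_cong by force
  then show A: "A = 0"
    by (simp add: tendsto_const_iff)
  have "W w * (C / w + D) = 0" if "w > 0" for w
    using eq[OF that] by (simp add: A B algebra_simps)
  then have "C / w + D = 0" if "w > 0" for w
    using W_pos[OF that] that by (metis less_irrefl mult_eq_0_iff)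
  from this[of 1] this[of 2] show "C = 0" "D = 0"
    by simp_all
qed

text \<open>\<open>c\<close> depends on the base point alone, so the right side displays the full
  dependence on the two free variables \<open>v\<close> and \<open>w\<close>.\<close>

lemma noether_lhs_eq:
  assumes "open \<Omega>" "\<Omega> \<subseteq> gas_dom n" "Cinf_vfield_on \<Omega> X" "j \<in> jets_over \<Omega>"
  defines "p \<equiv> base j"
  defines "c \<equiv> S (j VS) / (\<gamma> - 1) * P (j VPhi)" and "w \<equiv> j VPhi_s" and "v \<equiv> j VPhi_t"
  shows "noether_lhs (lagrangian n \<gamma> S) X j =
    - (xi_s X p * q * c * W w) + eta X p * R (j VPhi) * (c * (\<gamma> - 1)) * W w
    + (d_t (eta X) p + v * d_phi (eta X) p - v * (d_t (xi_t X) p + v * d_phi (xi_t X) p)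
        - w * (d_t (xi_s X) p + v * d_phi (xi_s X) p)) * v
    + (d_s (eta X) p + w * d_phi (eta X) p - v * (d_s (xi_t X) p + w * d_phi (xi_t X) p)
        - w * (d_s (xi_s X) p + w * d_phi (xi_s X) p)) * (c * (\<gamma> - 1)) * (W w / w)
    + (v\<^sup>2 / 2 - c * W w) *
      (d_t (xi_t X) p + v * d_phi (xi_t X) p + d_s (xi_s X) p + w * d_phi (xi_s X) p)"
proof -
  have j: "j \<in> J"
    using jets_over_mono[OF assms(2)] assms(4) by blast
  have p: "base j \<in> \<Omega>"
    using assms(4) by (simp add: jets_over_def)
  have diff: "xi_t X differentiable at (base j)" "xi_s X differentiable at (base j)"
    "eta X differentiable at (base j)"
    using assms(3) Cinf_on_differentiable[OF _ assms(1) p] by (auto simp: Cinf_vfield_on_def)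
  have S: "S (j VS) * P (j VPhi) = c * (\<gamma> - 1)"
    using gamma_minus_one by (simp add: c_def)
  show ?thesis
    unfolding noether_lhs_def pr1_def eta_t_def eta_s_def pd_lagrangian[OF j]
      diff[THEN Dt_lift] diff[THEN Ds_lift]
    unfolding lagrangian_eq lift_def p_def[symmetric] v_def[symmetric] w_def[symmetric]
    using S by (simp add: c_def) (simp add: field_simps)
qed

lemma noether_determining_equations:
  assumes "open \<Omega>" "\<Omega> \<subseteq> gas_dom n" "Cinf_vfield_on \<Omega> X" "Cinf_on \<Omega> B1" "Cinf_on \<Omega> B2"
    and noether: "\<forall>j\<in>jets_over \<Omega>.
      noether_lhs (lagrangian n \<gamma> S) X j = Dt (lift B1) j + Ds (lift B2) j"
    and p: "p \<in> \<Omega>"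
  shows "d_s (xi_t X) p = 0" "d_phi (xi_t X) p = 0"
    and "d_t (xi_s X) p = 0" "d_phi (xi_s X) p = 0"
    and "d_s (eta X) p = 0"
    and "2 * d_phi (eta X) p = d_t (xi_t X) p - d_s (xi_s X) p"
    and "d_phi B1 p = d_t (eta X) p" "d_t B1 p + d_s B2 p = 0" "d_phi B2 p = 0"
    and "q * xi_s X p + d_t (xi_t X) p + d_s (xi_s X) p
      = (\<gamma> - 1) * (R (snd (snd p)) * eta X p + d_phi (eta X) p - d_s (xi_s X) p)"
proof -
  obtain t s \<phi> where pe: "p = (t, s, \<phi>)" by (cases p)
  define c where "c = S s / (\<gamma> - 1) * P \<phi>"
  define k where "k = c * (\<gamma> - 1)"
  have \<phi>: "\<phi> > 0 \<or> n = 0"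
    using p assms(2) by (auto simp: pe gas_dom_def)
  have c: "c > 0"
    using S_pos P_pos[OF \<phi>] \<gamma> by (simp add: c_def)
  have k: "k > 0"
    using c \<gamma> by (simp add: k_def)
  let ?a = "xi_t X" and ?b = "xi_s X" and ?h = "eta X"
  have key: "- (?b p * q * c * W w) + ?h p * R \<phi> * k * W w
    + (d_t ?h p + v * d_phi ?h p - v * (d_t ?a p + v * d_phi ?a p)
        - w * (d_t ?b p + v * d_phi ?b p)) * v
    + (d_s ?h p + w * d_phi ?h p - v * (d_s ?a p + w * d_phi ?a p)
        - w * (d_s ?b p + w * d_phi ?b p)) * k * (W w / w)
    + (v\<^sup>2 / 2 - c * W w) * (d_t ?a p + v * d_phi ?a p + d_s ?b p + w * d_phi ?b p)
    = d_t B1 p + v * d_phi B1 p + d_s B2 p + w * d_phi B2 p"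
    if "w > 0" for v w
  proof -
    \<comment> \<open>A jet over \<open>p\<close> with arbitrary slope \<open>v\<close> and positive
      \<open>w\<close>. The Noether identity is of first order, so the second-order coordinates may
      be set to 0.\<close>
    define j :: jet where
      "j = (\<lambda>_. 0)(VT := t, VS := s, VPhi := \<phi>, VPhi_t := v, VPhi_s := w)"
    have j: "base j = p" "j VS = s" "j VPhi = \<phi>" "j VPhi_t = v" "j VPhi_s = w"
      by (simp_all add: j_def base_def pe)
    have jJ: "j \<in> jets_over \<Omega>"
      using p that by (simp add: jets_over_def j)
    have "B1 differentiable at (base j)" "B2 differentiable at (base j)"
      unfolding j using assms(1,4,5) p Cinf_on_differentiable by blast+
    then have "Dt (lift B1) j + Ds (lift B2) j
        = d_t B1 p + v * d_phi B1 p + (d_s B2 p + w * d_phi B2 p)"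
      by (simp add: Dt_lift Ds_lift j)
    with bspec[OF noether jJ] show ?thesis
      unfolding noether_lhs_eq[OF assms(1-3) jJ] j c_def k_def by (simp add: algebra_simps)
  qed
  have coeffs:
    "- (?b p * q * c * W w) + ?h p * R \<phi> * k * W w
      + (d_s ?h p + w * d_phi ?h p - w * (d_s ?b p + w * d_phi ?b p)) * k * (W w / w)
      - c * W w * (d_t ?a p + d_s ?b p + w * d_phi ?b p)
      - (d_t B1 p + d_s B2 p + w * d_phi B2 p) = 0"
    "d_t ?h p - w * d_t ?b p - (d_s ?a p + w * d_phi ?a p) * k * (W w / w)
      - c * W w * d_phi ?a p - d_phi B1 p = 0"
    "d_phi ?h p - d_t ?a p - w * d_phi ?b p + (d_t ?a p + d_s ?b p + w * d_phi ?b p) / 2 = 0"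
    "- d_phi ?a p / 2 = 0" if "w > 0" for w
  proof -
    have "(- (?b p * q * c * W w) + ?h p * R \<phi> * k * W w
      + (d_s ?h p + w * d_phi ?h p - w * (d_s ?b p + w * d_phi ?b p)) * k * (W w / w)
      - c * W w * (d_t ?a p + d_s ?b p + w * d_phi ?b p)
      - (d_t B1 p + d_s B2 p + w * d_phi B2 p))
      + (d_t ?h p - w * d_t ?b p - (d_s ?a p + w * d_phi ?a p) * k * (W w / w)
      - c * W w * d_phi ?a p - d_phi B1 p) * v
      + (d_phi ?h p - d_t ?a p - w * d_phi ?b p
      + (d_t ?a p + d_s ?b p + w * d_phi ?b p) / 2) * v\<^sup>2
      + (- d_phi ?a p / 2) * v ^ 3 = 0" for v
    proof -
      \<comment> \<open>Keeps the quotient as an unknown of its own while the other denominators are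
        cleared.\<close>
      define U where "U = W w / w"
      show ?thesis
        using key[OF that, of v] unfolding U_def[symmetric]
        by (simp add: field_simps power2_eq_square power3_eq_cube)
    qed
    from cubic_coefficients_zero[OF this] show
      "- (?b p * q * c * W w) + ?h p * R \<phi> * k * W w
      + (d_s ?h p + w * d_phi ?h p - w * (d_s ?b p + w * d_phi ?b p)) * k * (W w / w)
      - c * W w * (d_t ?a p + d_s ?b p + w * d_phi ?b p)
      - (d_t B1 p + d_s B2 p + w * d_phi B2 p) = 0"
    "d_t ?h p - w * d_t ?b p - (d_s ?a p + w * d_phi ?a p) * k * (W w / w)
      - c * W w * d_phi ?a p - d_phi B1 p = 0"
    "d_phi ?h p - d_t ?a p - w * d_phi ?b p + (d_t ?a p + d_s ?b p + w * d_phi ?b p) / 2 = 0"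
    "- d_phi ?a p / 2 = 0"
      by blast+
  qed
  show a_phi: "d_phi ?a p = 0"
    using coeffs(4)[of 1] by simp
  \<comment> \<open>The \<open>v^2\<close> coefficient is affine in \<open>w\<close> with slope
    \<open>- b_phi / 2\<close>; two values of \<open>w\<close> isolate the slope.\<close>
  show b_phi: "d_phi ?b p = 0"
    using coeffs(3)[of 1] coeffs(3)[of 2] by (simp add: field_simps)
  show "2 * d_phi ?h p = d_t ?a p - d_s ?b p"
    using coeffs(3)[of 1] by (simp add: b_phi field_simps)
  have "(d_t ?h p - d_phi B1 p) + (- d_t ?b p) * w + (- (k * d_s ?a p)) * (W w / w) + 0 * W w = 0"
    if "w > 0" for w
    using coeffs(2)[OF that] by (simp add: a_phi algebra_simps)
  from W_coefficients_zero[OF this] k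
  show "d_phi B1 p = d_t ?h p" "d_t ?b p = 0" "d_s ?a p = 0"
    by simp_all
  \<comment> \<open>The coefficient of \<open>W w\<close>. It is \<open>c\<close> times the
    difference of the two sides of the last determining equation, and \<open>c\<close> is
    positive.\<close>
  define E where "E = - (?b p * q * c) + ?h p * R \<phi> * k + (d_phi ?h p - d_s ?b p) * k
    - c * (d_t ?a p + d_s ?b p)"
  have "(- (d_t B1 p + d_s B2 p)) + (- d_phi B2 p) * w + (k * d_s ?h p) * (W w / w) + E * W w = 0"
    if "w > 0" for w
    using coeffs(1)[OF that] that by (simp add: b_phi E_def field_simps)
  from W_coefficients_zero[OF this] k
  show "d_t B1 p + d_s B2 p = 0" "d_phi B2 p = 0" "d_s ?h p = 0" and
    "q * ?b p + d_t ?a p + d_s ?b p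
      = (\<gamma> - 1) * (R (snd (snd p)) * ?h p + d_phi ?h p - d_s ?b p)"
  proof (simp_all, goal_cases)
    case 1
    have "E = c * ((\<gamma> - 1) * (R \<phi> * ?h p + d_phi ?h p - d_s ?b p) - (q * ?b p + d_t ?a p + d_s ?b p))"
      unfolding E_def k_def by (simp add: algebra_simps)
    with 1 c show ?case by (simp add: pe)
  qed
qed

section \<open>Integration of the determining equations on a connected domain\<close>

lemma noether_symmetry_imp_quadratic:
  assumes \<Omega>: "open \<Omega>" "connected \<Omega>" "\<Omega> \<noteq> {}" "\<Omega> \<subseteq> gas_dom n"
    and X: "noether_symmetry \<Omega> (lagrangian n \<gamma> S) X"
  obtains a0 a1 a2 b c0 c1 where "quadratic_on \<Omega> X a0 a1 a2 b c0 c1"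
    "q * b = a1 * \<kappa>" "a2 * \<kappa> = 0" "n \<noteq> 0 \<Longrightarrow> c0 = 0 \<and> c1 = 0"
proof -
  obtain B1 B2 where B: "Cinf_on \<Omega> B1" "Cinf_on \<Omega> B2"
    and noether: "\<forall>j\<in>jets_over \<Omega>.
      noether_lhs (lagrangian n \<gamma> S) X j = Dt (lift B1) j + Ds (lift B2) j"
    and CX: "Cinf_vfield_on \<Omega> X"
    using X unfolding noether_symmetry_def by blast
  define a b h where "a = xi_t X" and "b = xi_s X" and "h = eta X"
  note eqs = noether_determining_equations[OF \<Omega>(1,4) CX B noether, folded a_def b_def h_def]
  have C: "Cinf_on \<Omega> a" "Cinf_on \<Omega> b" "Cinf_on \<Omega> h"
    using CX by (auto simp: Cinf_vfield_on_def a_def b_def h_def)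
  have basis: "(1, 0, 0) \<in> (Basis :: point set)" "(0, 1, 0) \<in> (Basis :: point set)"
    "(0, 0, 1) \<in> (Basis :: point set)"
    by (auto simp: Basis_point)
  note C1 = Cinf_on_dirder[OF _ basis(1)] Cinf_on_dirder[OF _ basis(2)] Cinf_on_dirder[OF _ basis(3)]
  note dif = Cinf_on_differentiable[OF _ \<Omega>(1)]
  note mixed = Cinf_on_mixed_zero_if_dirder_zero[OF _ \<Omega>(1)]
  note cong = dirder_cong[OF \<Omega>(1)]
  note const = dirder_zero_if_constant_on[OF \<Omega>(1)]
  note grad = constant_if_gradient_zero[OF \<Omega>(1,2)]

  have at: "d_s (d_t a) p = 0" "d_phi (d_t a) p = 0" if "p \<in> \<Omega>" for p
    using mixed[OF C(1) basis(1,2) eqs(1) that] mixed[OF C(1) basis(1,3) eqs(2) that] by auto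
  have hphi_s: "d_s (d_phi h) p = 0" if "p \<in> \<Omega>" for p
    using mixed[OF C(3) basis(3,2) eqs(5) that] .
  \<comment> \<open>\<open>b_s\<close> equals \<open>a_t - 2 h_phi\<close>, and neither term varies
    with \<open>s\<close>.\<close>
  have b_ss: "d_s (d_s b) p = 0" if p: "p \<in> \<Omega>" for p
  proof -
    have "d_s (d_s b) p = d_s (\<lambda>x. d_t a x - 2 * d_phi h x) p"
      by (rule cong[OF p]) (use eqs(6) C C1 dif p in auto)
    also have "\<dots> = d_s (d_t a) p - 2 * d_s (d_phi h) p"
      using dif[OF C1(1)[OF C(1)] p] dif[OF C1(3)[OF C(3)] p]
      by (simp add: dirder_diff dirder_cmult)
    finally show ?thesis using at hphi_s p by simp
  qed
  (* Along the s-axis phi is constant, and every term of the last determining equation except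
     q b is stationary. *)
  have b_s: "d_s b p = 0" if p: "p \<in> \<Omega>" for p
  proof -
    define r where "r = R (snd (snd p))"
    define G where "G = (\<lambda>x. q * b x + d_t a x + d_s b x - (\<gamma> - 1) * (r * h x + d_phi h x - d_s b x))"
    define e where "e = (0 :: real, 1 :: real, 0 :: real)"
    have D: "((\<lambda>x. f (p + x *\<^sub>R e)) has_real_derivative d_s f p) (at 0)" if "Cinf_on \<Omega> f" for f
      using DERIV_dirder[of f p 0 e] dif[OF that p] unfolding e_def[symmetric] by simp
    have "((\<lambda>x. G (p + x *\<^sub>R e)) has_real_derivative q * d_s b p + d_s (d_t a) p + d_s (d_s b) p
        - (\<gamma> - 1) * (r * d_s h p + d_s (d_phi h) p - d_s (d_s b) p)) (at 0)"
      unfolding G_def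
      by (intro DERIV_diff DERIV_add DERIV_cmult D C C1)
    then have "((\<lambda>x. G (p + x *\<^sub>R e)) has_real_derivative q * d_s b p) (at 0)"
      using at b_ss hphi_s eqs(5) p by simp
    moreover have "((\<lambda>x. G (p + x *\<^sub>R e)) has_real_derivative 0) (at 0)"
    proof (rule has_field_derivative_transform_within_open)
      show "((\<lambda>_. 0) has_real_derivative 0) (at (0 :: real))" by simp
      show "open ((\<lambda>x :: real. p + x *\<^sub>R e) -` \<Omega>)"
        by (intro open_vimage \<Omega>(1) continuous_intros)
      show "0 \<in> (\<lambda>x :: real. p + x *\<^sub>R e) -` \<Omega>" using p by simp
      fix x :: real assume "x \<in> (\<lambda>x. p + x *\<^sub>R e) -` \<Omega>"
      then show "0 = G (p + x *\<^sub>R e)"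
        using eqs(10)[of "p + x *\<^sub>R e"] by (simp add: G_def r_def e_def)
    qed
    ultimately have "q * d_s b p = 0" by (rule DERIV_unique)
    then show ?thesis using q by simp
  qed
  obtain b0 where b0: "\<And>p. p \<in> \<Omega> \<Longrightarrow> b p = b0"
    using grad[OF dif[OF C(2)] eqs(3) b_s eqs(4)] by blast
  have h_phi: "d_phi h p = d_t a p / 2" if "p \<in> \<Omega>" for p
    using eqs(6)[OF that] b_s[OF that] by simp
  have star: "q * b0 + d_t a p = (\<gamma> - 1) * (R (snd (snd p)) * h p + d_t a p / 2)" if "p \<in> \<Omega>" for p
    using eqs(10)[OF that] by (simp add: b_s[OF that] h_phi[OF that] b0[OF that])
  have phi_pos: "snd (snd p) > 0" if "p \<in> \<Omega>" "n \<noteq> 0" for p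
    using \<Omega>(4) that by (auto simp: gas_dom_def)
  \<comment> \<open>The denominator of \<open>R\<close> is cleared so that the relation can be
    differentiated in \<open>phi\<close>.\<close>
  have star_phi: "snd (snd p) * (q * b0 + d_t a p) = (\<gamma> - 1) * (real n * h p + snd (snd p) * (d_t a p / 2))"
    if "p \<in> \<Omega>" "n \<noteq> 0" for p
    unfolding star[OF that(1)] using phi_pos[OF that] by (simp add: R_def field_simps)
  \<comment> \<open>For \<open>n = 0\<close> the \<open>R\<close> term is absent and
    \<open>star\<close> is already the claim. Otherwise \<open>star_phi\<close> is differentiated in
    \<open>phi\<close>, where \<open>a_t\<close> is constant and \<open>h_phi\<close> is
    \<open>a_t / 2\<close>.\<close>
  have a_t: "2 * q * b0 = \<kappa> * d_t a p" if p: "p \<in> \<Omega>" for p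
  proof (cases "n = 0")
    case True
    then have n: "real n = 0" by simp
    then have "R (snd (snd p)) = 0" unfolding R_def by simp
    with star[OF p] show ?thesis unfolding \<kappa>_def n by (simp add: field_simps)
  next
    case False
    define G where "G = (\<lambda>x. snd (snd x) * (q * b0 + d_t a x)
      - (\<gamma> - 1) * (real n * h x + snd (snd x) * (d_t a x / 2)))"
    note d = dif[OF C1(1)[OF C(1)] p] dif[OF C(3) p] differentiable_coordinates(2)[of p]
    have "d_phi G p = (q * b0 + d_t a p) - (\<gamma> - 1) * (real n * (d_t a p / 2) + d_t a p / 2)"
      unfolding G_def using d at[OF p] h_phi[OF p]
      by (simp add: dirder_add dirder_diff dirder_mult dirder_cmult dirder_cdivide dirder_coordinates differentiable_cdivide differentiable_mult)
    moreover have "d_phi G p = 0"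
      by (rule const[OF p]) (use star_phi False in \<open>simp add: G_def\<close>)
    ultimately show ?thesis by (simp add: \<kappa>_def field_simps)
  qed
  \<comment> \<open>Substituting the value of \<open>q * b0\<close> back into
    \<open>star_phi\<close> leaves \<open>h\<close> as the only unknown.\<close>
  have h_eq: "h p = snd (snd p) * (d_t a p / 2)" if p: "p \<in> \<Omega>" and n: "n \<noteq> 0" for p
  proof -
    have "(\<gamma> - 1) * real n * h p = (\<gamma> - 1) * real n * (snd (snd p) * (d_t a p / 2))"
    proof -
      have "q * b0 = \<kappa> * d_t a p / 2" using a_t[OF p] by simp
      from star_phi[OF that, unfolded this] show ?thesis by (simp add: \<kappa>_def field_simps)
    qed
    then show ?thesis using n gamma_minus_one by simp
  qed

  (* k is the part of h that depends on t alone. It vanishes for n > 0 and is affine in t for n = 0. *)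
  define k where "k = (\<lambda>x. h x - snd (snd x) * d_t a x / 2)"
  have k: "Cinf_on \<Omega> k"
    unfolding k_def
  proof -
    have "Cinf_on \<Omega> (\<lambda>x. h x + (- 1 / 2) * (snd (snd x) * d_t a x))"
      by (intro Cinf_on_add Cinf_on_mult Cinf_on_const \<Omega>(1) C C1)
        (auto intro!: Cinf_on_linear bounded_linear_intros)
    then show "Cinf_on \<Omega> (\<lambda>x. h x - snd (snd x) * d_t a x / 2)"
      by simp
  qed
  have dk: "dirder e k p = dirder e h p - (snd (snd p) * dirder e (d_t a) p + snd (snd e) * d_t a p) / 2"
    if p: "p \<in> \<Omega>" for e p
    unfolding k_def
    using dif[OF C1(1)[OF C(1)] p] dif[OF C(3) p] differentiable_coordinates(2)[of p]
    by (simp add: dirder_add dirder_diff dirder_mult dirder_cmult dirder_cdivide dirder_coordinates differentiable_cdivide differentiable_mult)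
  have k_s: "d_s k p = 0" and k_phi: "d_phi k p = 0" if "p \<in> \<Omega>" for p
    using dk[OF that] at[OF that] eqs(5)[OF that] h_phi[OF that] by simp_all
  have h_tt: "d_t (d_t h) p = 0" if p: "p \<in> \<Omega>" for p
  proof -
    have "d_phi (d_t B1) x = 0" if x: "x \<in> \<Omega>" for x
    proof -
      have "d_phi (d_t B1) x = d_phi (\<lambda>x. - 1 * d_s B2 x) x"
        by (rule cong[OF x]) (use eqs(8) B C1 dif x in \<open>auto simp: add_eq_0_iff\<close>)
      also have "\<dots> = - 1 * d_phi (d_s B2) x"
        using dif[OF C1(2)[OF B(2)] x] by (rule dirder_cmult)
      also have "d_phi (d_s B2) x = 0"
        using mixed[OF B(2) basis(2,3) eqs(9) x] .
      finally show ?thesis by simp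
    qed
    then have "d_t (d_phi B1) p = 0"
      using Cinf_on_mixed_zero[OF B(1) \<Omega>(1) basis(1,3) _ p] by blast
    moreover have "d_t (d_t h) p = d_t (d_phi B1) p"
      by (rule cong[OF p]) (use eqs(7) C C1 dif p in auto)
    ultimately show ?thesis by simp
  qed
  define a_tt where "a_tt = d_t (d_t a)"
  have Ca_tt: "Cinf_on \<Omega> a_tt"
    unfolding a_tt_def by (intro C1 C)
  have a_tt: "d_s a_tt p = 0" "d_phi a_tt p = 0" if "p \<in> \<Omega>" for p
    unfolding a_tt_def
    using mixed[OF C1(1)[OF C(1)] basis(1,2) at(1) that] mixed[OF C1(1)[OF C(1)] basis(1,3) at(2) that]
    by auto
  have k_tt: "d_t (d_t k) p = - (snd (snd p) * d_t a_tt p / 2)" if p: "p \<in> \<Omega>" for p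
  proof -
    have "d_t (d_t k) p = d_t (\<lambda>x. d_t h x - snd (snd x) * a_tt x / 2) p"
      by (rule cong[OF p]) (use dk dif[OF C1(1)[OF k] p] in \<open>auto simp: a_tt_def\<close>)
    also have "\<dots> = - (snd (snd p) * d_t a_tt p / 2)"
      using dif[OF Ca_tt p] dif[OF C1(1)[OF C(3)] p] differentiable_coordinates(2)[of p] h_tt[OF p]
      by (simp add: dirder_add dirder_diff dirder_mult dirder_cmult dirder_cdivide dirder_coordinates differentiable_cdivide differentiable_mult)
    finally show ?thesis .
  qed
  have kt: "d_s (d_t k) p = 0" "d_phi (d_t k) p = 0" if "p \<in> \<Omega>" for p
    using mixed[OF k basis(1,2) k_s that] mixed[OF k basis(1,3) k_phi that] by auto
  (* In k_tt = - phi a_ttt / 2 neither k_tt nor a_ttt varies with phi. *)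
  have a_ttt: "d_t a_tt p = 0" if p: "p \<in> \<Omega>" for p
  proof -
    have "0 = d_phi (d_t (d_t k)) p"
      using mixed[OF C1(1)[OF k] basis(1,3) kt(2) p] by simp
    also have "\<dots> = d_phi (\<lambda>x. snd (snd x) * d_t a_tt x / (- 2)) p"
      by (rule cong[OF p]) (use k_tt dif[OF C1(1)[OF C1(1)[OF k]] p] in auto)
    also have "\<dots> = (snd (snd p) * d_phi (d_t a_tt) p + d_t a_tt p) / (- 2)"
      using dif[OF C1(1)[OF Ca_tt] p] differentiable_coordinates(2)[of p]
      by (simp del: divide_minus_right add: dirder_mult dirder_cmult dirder_cdivide dirder_coordinates differentiable_cdivide differentiable_mult)
    also have "d_phi (d_t a_tt) p = 0"
      using mixed[OF Ca_tt basis(1,3) a_tt(2) p] .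
    finally show ?thesis by simp
  qed
  obtain a2' where a2': "\<And>p. p \<in> \<Omega> \<Longrightarrow> a_tt p = a2'"
    using grad[OF dif[OF Ca_tt] a_ttt a_tt] by blast
  \<comment> \<open>Halved to match \<open>quad_field\<close>, whose time component has second
    derivative \<open>2 * a2\<close>; \<open>a1\<close> below is halved for the same reason.\<close>
  define a2 where "a2 = a2' / 2"
  have a2: "d_t (d_t a) p = 2 * a2" if "p \<in> \<Omega>" for p
    using a2'[OF that] by (simp add: a2_def a_tt_def)
  obtain a1' where a1': "\<And>p. p \<in> \<Omega> \<Longrightarrow> d_t a p - 2 * a2 * fst p = a1'"
  proof (rule grad[of "\<lambda>p. d_t a p - 2 * a2 * fst p"])
    fix p assume p: "p \<in> \<Omega>"
    note d = dif[OF C1(1)[OF C(1)] p] differentiable_coordinates(1)[of p]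
    show "(\<lambda>p. d_t a p - 2 * a2 * fst p) differentiable at p"
      using d by (intro differentiable_diff differentiable_mult differentiable_const)
    show "d_t (\<lambda>p. d_t a p - 2 * a2 * fst p) p = 0" "d_s (\<lambda>p. d_t a p - 2 * a2 * fst p) p = 0"
      "d_phi (\<lambda>p. d_t a p - 2 * a2 * fst p) p = 0"
      using d a2[OF p] at[OF p]
      by (simp_all add: dirder_diff dirder_cmult dirder_cdivide dirder_coordinates differentiable_cdivide differentiable_mult)
  qed blast
  define a1 where "a1 = a1' / 2"
  have a1: "d_t a p = 2 * (a1 + a2 * fst p)" if "p \<in> \<Omega>" for p
    using a1'[OF that] by (simp add: a1_def)
  obtain a0 where a0: "\<And>p. p \<in> \<Omega> \<Longrightarrow> a p - (2 * a1 * fst p + a2 * (fst p * fst p)) = a0"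
  proof (rule grad[of "\<lambda>p. a p - (2 * a1 * fst p + a2 * (fst p * fst p))"])
    fix p assume p: "p \<in> \<Omega>"
    note d = dif[OF C(1) p] differentiable_coordinates(1)[of p]
    let ?f = "\<lambda>p. a p - (2 * a1 * fst p + a2 * (fst p * fst p))"
    show "?f differentiable at p"
      using d by (intro differentiable_diff differentiable_add differentiable_mult differentiable_const)
    show "d_t ?f p = 0" "d_s ?f p = 0" "d_phi ?f p = 0"
      using d a1[OF p] eqs(1,2)[OF p]
      by (simp_all add: dirder_diff dirder_add dirder_diff dirder_mult dirder_cmult dirder_cdivide dirder_coordinates differentiable_cdivide
          differentiable_mult differentiable_add algebra_simps)
  qed blast
  have k_tt0: "d_t (d_t k) p = 0" if "p \<in> \<Omega>" for p
    using k_tt[OF that] a_ttt[OF that] by simp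
  obtain c1 where c1: "\<And>p. p \<in> \<Omega> \<Longrightarrow> d_t k p = c1"
    using grad[OF dif[OF C1(1)[OF k]] k_tt0 kt] by blast
  obtain c0 where c0: "\<And>p. p \<in> \<Omega> \<Longrightarrow> k p - c1 * fst p = c0"
  proof (rule grad[of "\<lambda>p. k p - c1 * fst p"])
    fix p assume p: "p \<in> \<Omega>"
    note d = dif[OF k p] differentiable_coordinates(1)[of p]
    show "(\<lambda>p. k p - c1 * fst p) differentiable at p"
      using d by (intro differentiable_diff differentiable_mult differentiable_const)
    show "d_t (\<lambda>p. k p - c1 * fst p) p = 0" "d_s (\<lambda>p. k p - c1 * fst p) p = 0"
      "d_phi (\<lambda>p. k p - c1 * fst p) p = 0"
      using d c1[OF p] k_s[OF p] k_phi[OF p]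
      by (simp_all add: dirder_diff dirder_cmult dirder_cdivide dirder_coordinates differentiable_cdivide differentiable_mult)
  qed blast
  obtain p0 where p0: "p0 \<in> \<Omega>" using \<Omega>(3) by blast
  show ?thesis
  proof (rule that)
    show "quadratic_on \<Omega> X a0 a1 a2 b0 c0 c1"
    proof
      fix p assume p: "p \<in> \<Omega>"
      have "xi_t X p = a0 + 2 * a1 * fst p + a2 * (fst p)\<^sup>2"
        using a0[OF p] by (simp add: a_def power2_eq_square)
      moreover have "xi_s X p = b0"
        using b0[OF p] by (simp add: b_def)
      moreover have "eta X p = (a1 + a2 * fst p) * snd (snd p) + c0 + c1 * fst p"
        using c0[OF p] a1[OF p] by (simp add: k_def h_def algebra_simps)
      ultimately show "X p = quad_field a0 a1 a2 b0 c0 c1 p"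
        by (simp add: quad_field_def xi_t_def xi_s_def eta_def split_beta prod_eq_iff)
    qed (rule \<Omega>(1))
    \<comment> \<open>The product of \<kappa> and \<open>a_t\<close> is the constant
      \<open>2 * q * b0\<close>, while the \<open>t\<close>-derivative of \<open>a_t\<close> is
      \<open>2 * a2\<close>.\<close>
    have "d_t (\<lambda>x. \<kappa> * d_t a x) p0 = 0"
  by (rule const[OF p0 a_t[symmetric]])
    then show a2_\<kappa>: "a2 * \<kappa> = 0"
      using dif[OF C1(1)[OF C(1)] p0] a2[OF p0] by (auto simp: dirder_cmult)
    have "q * b0 = a1 * \<kappa> + fst p0 * (a2 * \<kappa>)"
      using a_t[OF p0] unfolding a1[OF p0] by (simp add: algebra_simps)
    then show "q * b0 = a1 * \<kappa>" by (simp add: a2_\<kappa>)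
    show "c0 = 0 \<and> c1 = 0" if n: "n \<noteq> 0"
    proof -
      have k0: "k p = 0" if "p \<in> \<Omega>" for p
        using h_eq[OF that n] by (simp add: k_def)
      then have "c1 = 0"
        using const[OF p0 k0] c1[OF p0] by simp
      with c0[OF p0] k0[OF p0] show ?thesis by simp
    qed
  qed
qed

end

section \<open>The span\<close>

lemma zero_in_span_on: "(\<lambda>_. 0) \<in> span_on \<Omega> V"
  unfolding span_on_def by (auto intro: exI[of _ "\<lambda>_. 0"])

text \<open>Adding one generator at a time only changes one coefficient, so it does not matter
  whether listed fields coincide, as \<open>Z2\<close> and \<open>scaling_field\<close> do for
  \<open>q = 1\<close> and \<gamma> = \<open>gamma_star n\<close>.\<close>

lemma span_on_add_scaled:
  assumes "finite V" "Y \<in> V" "X \<in> span_on \<Omega> V"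
  shows "(\<lambda>p. r *\<^sub>R Y p + X p) \<in> span_on \<Omega> V"
proof -
  obtain c where c: "\<And>p. p \<in> \<Omega> \<Longrightarrow> X p = (\<Sum>Z\<in>V. c Z *\<^sub>R Z p)"
    using assms(3) unfolding span_on_def by blast
  have "(\<Sum>Z\<in>V. (c Z + (if Z = Y then r else 0)) *\<^sub>R Z p)
      = r *\<^sub>R Y p + (\<Sum>Z\<in>V. c Z *\<^sub>R Z p)" for p
  proof -
    have "(\<Sum>Z\<in>V. (if Z = Y then r else 0) *\<^sub>R Z p) = (\<Sum>Z\<in>V. if Z = Y then r *\<^sub>R Z p else 0)"
      by (intro sum.cong) auto
    also have "\<dots> = r *\<^sub>R Y p"
      using assms(1,2) by simp
    finally show ?thesis by (simp add: scaleR_add_left sum.distrib)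
  qed
  then show ?thesis
    using c unfolding span_on_def
    by (intro CollectI exI[of _ "\<lambda>Z. c Z + (if Z = Y then r else 0)"]) simp
qed

lemma span_on_cong: "(\<And>p. p \<in> \<Omega> \<Longrightarrow> X p = Y p) \<Longrightarrow> X \<in> span_on \<Omega> V \<longleftrightarrow> Y \<in> span_on \<Omega> V"
  unfolding span_on_def by simp

lemma quad_field_add_scaled:
  "r *\<^sub>R quad_field a0 a1 a2 b c0 c1 p + quad_field a0' a1' a2' b' c0' c1' p
    = quad_field (r * a0 + a0') (r * a1 + a1') (r * a2 + a2') (r * b + b')
        (r * c0 + c0') (r * c1 + c1') p"
  by (cases p) (simp add: quad_field_def algebra_simps)

lemma finite_arbitrary_entropy_fields: "finite (arbitrary_entropy_fields n \<gamma>)"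
  unfolding arbitrary_entropy_fields_def by simp

lemma gamma_star_iff: "\<gamma> = gamma_star n \<longleftrightarrow> (real n + 1) * \<gamma> - real n - 3 = 0"
  unfolding gamma_star_def by (auto simp: field_simps)

context exponential_gas
begin

text \<open>The constraints on the parameters are linear, so the set \<open>Q\<close> of admissible
  normal forms is closed under linear combinations and only the generators have to be
  checked.\<close>

lemma span_on_imp_quadratic:
  assumes "open \<Omega>" "X \<in> span_on \<Omega> (insert (Z2 n \<gamma> q) (arbitrary_entropy_fields n \<gamma>))"
  obtains a0 a1 a2 b c0 c1 where "quadratic_on \<Omega> X a0 a1 a2 b c0 c1"
    "q * b = a1 * \<kappa>" "a2 * \<kappa> = 0" "n \<noteq> 0 \<Longrightarrow> c0 = 0 \<and> c1 = 0"
proof -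
  define V where "V = insert (Z2 n \<gamma> q) (arbitrary_entropy_fields n \<gamma>)"
  define Q where "Q = {Y. \<exists>a0 a1 a2 b c0 c1. Y = quad_field a0 a1 a2 b c0 c1 \<and>
    q * b = a1 * \<kappa> \<and> a2 * \<kappa> = 0 \<and> (n \<noteq> 0 \<longrightarrow> c0 = 0 \<and> c1 = 0)}"
  have Q: "quad_field a0 a1 a2 b c0 c1 \<in> Q"
    if "q * b = a1 * \<kappa>" "a2 * \<kappa> = 0" "n \<noteq> 0 \<longrightarrow> c0 = 0 \<and> c1 = 0" for a0 a1 a2 b c0 c1
    using that unfolding Q_def by blast
  have V: "Y \<in> Q" if "Y \<in> V" for Y
  proof -
    have eqs: "Z2 n \<gamma> q = quad_field 0 q 0 \<kappa> 0 0"
      "(\<lambda>(t, s, \<phi>). (1, 0, 0)) = quad_field 1 0 0 0 0 0"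
      "(\<lambda>(t, s, \<phi>). (0, 0, 1)) = quad_field 0 0 0 0 1 0"
      "(\<lambda>(t, s, \<phi>). (0, 0, t)) = quad_field 0 0 0 0 0 1"
      "scaling_field = quad_field 0 1 0 0 0 0"
      "(\<lambda>(t, s, \<phi>). (t\<^sup>2, 0, t * \<phi>)) = quad_field 0 0 1 0 0 0"
      by (auto simp: fun_eq_iff quad_field_def Z2_def \<kappa>_def scaling_field_def)
    have "Z2 n \<gamma> q \<in> Q" "(\<lambda>(t, s, \<phi>). (1, 0, 0)) \<in> Q"
      unfolding eqs by (auto intro!: Q)
    moreover have "(\<lambda>(t, s, \<phi>). (0, 0, 1)) \<in> Q" "(\<lambda>(t, s, \<phi>). (0, 0, t)) \<in> Q" if "n = 0"
      unfolding eqs by (auto intro!: Q simp: that)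
    moreover have "scaling_field \<in> Q" "(\<lambda>(t, s, \<phi>). (t\<^sup>2, 0, t * \<phi>)) \<in> Q"
      if "\<gamma> = gamma_star n"
    proof -
      have "\<kappa> = 0"
        using that unfolding gamma_star_iff \<kappa>_def .
      with q show "scaling_field \<in> Q" "(\<lambda>(t, s, \<phi>). (t\<^sup>2, 0, t * \<phi>)) \<in> Q"
        unfolding eqs by (auto intro!: Q)
    qed
    ultimately show ?thesis
      using that unfolding V_def arbitrary_entropy_fields_def by (auto split: if_splits)
  qed
  obtain c where c: "\<And>p. p \<in> \<Omega> \<Longrightarrow> X p = (\<Sum>Y\<in>V. c Y *\<^sub>R Y p)"
    using assms(2) unfolding span_on_def V_def by blast
  have "finite V"
    by (simp add: V_def finite_arbitrary_entropy_fields)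
  moreover have "(\<lambda>p. \<Sum>Y\<in>F. c Y *\<^sub>R Y p) \<in> Q" if "finite F" "F \<subseteq> V" for F
    using that
  proof (induction F rule: finite_induct)
    case empty
    have "(\<lambda>p. \<Sum>Y\<in>{}. c Y *\<^sub>R Y p) = quad_field 0 0 0 0 0 0"
      by (auto simp: fun_eq_iff quad_field_def zero_prod_def)
    then show ?case using Q[of 0 0 0 0 0 0] by simp
  next
    case (insert Y F)
    obtain a0 a1 a2 b c0 c1 where Y: "Y = quad_field a0 a1 a2 b c0 c1"
      "q * b = a1 * \<kappa>" "a2 * \<kappa> = 0" "n \<noteq> 0 \<longrightarrow> c0 = 0 \<and> c1 = 0"
      using V[of Y] insert.prems unfolding Q_def by auto
    obtain a0' a1' a2' b' c0' c1' where F: "(\<lambda>p. \<Sum>Y\<in>F. c Y *\<^sub>R Y p) = quad_field a0' a1' a2' b' c0' c1'"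
      "q * b' = a1' * \<kappa>" "a2' * \<kappa> = 0" "n \<noteq> 0 \<longrightarrow> c0' = 0 \<and> c1' = 0"
      using insert.IH insert.prems unfolding Q_def by auto
    have "(\<lambda>p. \<Sum>Y\<in>insert Y F. c Y *\<^sub>R Y p)
        = (\<lambda>p. c Y *\<^sub>R quad_field a0 a1 a2 b c0 c1 p + quad_field a0' a1' a2' b' c0' c1' p)"
      by (rule ext)
        (simp only: sum.insert[OF insert.hyps] Y(1)[symmetric] fun_cong[OF F(1), simplified])
    also have "\<dots> = quad_field (c Y * a0 + a0') (c Y * a1 + a1') (c Y * a2 + a2') (c Y * b + b')
        (c Y * c0 + c0') (c Y * c1 + c1')"
      by (simp add: fun_eq_iff quad_field_add_scaled)
    also have "\<dots> \<in> Q"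
    proof (rule Q)
      have "q * (c Y * b + b') = c Y * (q * b) + q * b'"
        by (simp add: algebra_simps)
      then show "q * (c Y * b + b') = (c Y * a1 + a1') * \<kappa>"
        unfolding Y(2) F(2) by (simp add: algebra_simps)
      have "(c Y * a2 + a2') * \<kappa> = c Y * (a2 * \<kappa>) + a2' * \<kappa>"
        by (simp add: algebra_simps)
      then show "(c Y * a2 + a2') * \<kappa> = 0"
        unfolding Y(3) F(3) by simp
    qed (use Y(4) F(4) in auto)
    finally show ?case .
  qed
  ultimately have "(\<lambda>p. \<Sum>Y\<in>V. c Y *\<^sub>R Y p) \<in> Q" by blast
  then obtain a0 a1 a2 b c0 c1 where "(\<lambda>p. \<Sum>Y\<in>V. c Y *\<^sub>R Y p) = quad_field a0 a1 a2 b c0 c1"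
    and params: "q * b = a1 * \<kappa>" "a2 * \<kappa> = 0" "n \<noteq> 0 \<longrightarrow> c0 = 0 \<and> c1 = 0"
    unfolding Q_def by blast
  then have "quadratic_on \<Omega> X a0 a1 a2 b c0 c1"
    using c assms(1) by unfold_locales (metis (no_types, lifting))+
  with params that show ?thesis by blast
qed

text \<open>If \<kappa> vanishes, then so does \<open>b\<close>, and the two extra fields of the
  special exponent carry \<open>a1\<close> and \<open>a2\<close>. Otherwise \<open>a2\<close>
  vanishes, and \<open>b\<close> and \<open>a1\<close> are fixed together by one multiple of
  \<open>Z2\<close>. The translations and the boost, collected in \<open>T\<close>, are common to
  both cases.\<close>

lemma quadratic_imp_span_on:
  assumes "quadratic_on \<Omega> X a0 a1 a2 b c0 c1"
    and "q * b = a1 * \<kappa>" "a2 * \<kappa> = 0" "n \<noteq> 0 \<Longrightarrow> c0 = 0 \<and> c1 = 0"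
  shows "X \<in> span_on \<Omega> (insert (Z2 n \<gamma> q) (arbitrary_entropy_fields n \<gamma>))"
proof -
  let ?V = "insert (Z2 n \<gamma> q) (arbitrary_entropy_fields n \<gamma>)"
  note add = span_on_add_scaled[OF finite.insertI[OF finite_arbitrary_entropy_fields]]
  define T where "T = (if n = 0
    then (\<lambda>(t, s, \<phi>). (a0, 0, c0 + c1 * t)) else (\<lambda>(t, s, \<phi>). (a0, 0, 0)) :: vfield)"
  have T: "T \<in> span_on \<Omega> ?V"
  proof (cases "n = 0")
    case True
    have "(\<lambda>p. a0 *\<^sub>R (\<lambda>(t, s, \<phi>). (1, 0, 0)) p + (c0 *\<^sub>R (\<lambda>(t, s, \<phi>). (0, 0, 1)) p +
        (c1 *\<^sub>R (\<lambda>(t, s, \<phi>). (0, 0, t)) p + 0))) \<in> span_on \<Omega> ?V"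
      by (intro add zero_in_span_on) (auto simp: arbitrary_entropy_fields_def True)
    then show ?thesis
      by (rule span_on_cong[THEN iffD1, rotated]) (auto simp: T_def True)
  next
    case False
    have "(\<lambda>p. a0 *\<^sub>R (\<lambda>(t, s, \<phi>). (1, 0, 0)) p + 0) \<in> span_on \<Omega> ?V"
      by (intro add zero_in_span_on) (auto simp: arbitrary_entropy_fields_def)
    then show ?thesis
      by (rule span_on_cong[THEN iffD1, rotated]) (auto simp: T_def False zero_prod_def)
  qed
  have X: "X p = quad_field a0 a1 a2 b c0 c1 p" if "p \<in> \<Omega>" for p
    using assms(1) that by (rule quadratic_on.quad)
  show ?thesis
  proof (cases "\<kappa> = 0")
    case True
    then have star: "\<gamma> = gamma_star n"
      unfolding gamma_star_iff \<kappa>_def .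
    have "b = 0" using assms(2) q True by simp
    have "(\<lambda>p. a1 *\<^sub>R scaling_field p + (a2 *\<^sub>R (\<lambda>(t, s, \<phi>). (t\<^sup>2, 0, t * \<phi>)) p + T p))
        \<in> span_on \<Omega> ?V"
      by (intro add T) (simp_all add: arbitrary_entropy_fields_def flip: star)
    then show ?thesis
      by (rule span_on_cong[THEN iffD1, rotated])
        (use X assms(4) \<open>b = 0\<close> in \<open>auto simp: T_def quad_field_def scaling_field_def algebra_simps\<close>)
  next
    case False
    \<comment> \<open>The \<open>s\<close>-component of \<open>Z2\<close> is \<kappa>, so its
      coefficient must be \<open>b / \<kappa>\<close>.\<close>
    then have "a2 = 0" "a1 = b / \<kappa> * q" "b = b / \<kappa> * \<kappa>"
      using assms(2,3) by (auto simp: field_simps)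
    have "(\<lambda>p. (b / \<kappa>) *\<^sub>R Z2 n \<gamma> q p + T p) \<in> span_on \<Omega> ?V"
      by (intro add T) simp
    then show ?thesis
    proof (rule span_on_cong[THEN iffD1, rotated])
      fix p assume p: "p \<in> \<Omega>"
      have "Z2 n \<gamma> q p = (2 * q * fst p, \<kappa>, q * snd (snd p))"
        by (simp add: Z2_def \<kappa>_def split_beta)
      then show "(b / \<kappa>) *\<^sub>R Z2 n \<gamma> q p + T p = X p"
        using assms(4) \<open>a2 = 0\<close> False unfolding X[OF p] \<open>a1 = b / \<kappa> * q\<close>
        by (auto simp: T_def quad_field_def split_beta algebra_simps)
    qed
  qed
qed

lemma noether_point_symmetries:
  assumes "open \<Omega>" "connected \<Omega>" "\<Omega> \<noteq> {}" "\<Omega> \<subseteq> gas_dom n"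
  shows "{X. point_symmetry \<Omega> (gas_eq n \<gamma> S) X \<and> noether_symmetry \<Omega> (lagrangian n \<gamma> S) X}
    = span_on \<Omega> (insert (Z2 n \<gamma> q) (arbitrary_entropy_fields n \<gamma>))"
proof (intro equalityI subsetI)
  fix X assume "X \<in> {X. point_symmetry \<Omega> (gas_eq n \<gamma> S) X \<and> noether_symmetry \<Omega> (lagrangian n \<gamma> S) X}"
  then have "noether_symmetry \<Omega> (lagrangian n \<gamma> S) X" by blast
  from noether_symmetry_imp_quadratic[OF assms this] quadratic_imp_span_on
  show "X \<in> span_on \<Omega> (insert (Z2 n \<gamma> q) (arbitrary_entropy_fields n \<gamma>))"
    by metis
next
  fix X assume "X \<in> span_on \<Omega> (insert (Z2 n \<gamma> q) (arbitrary_entropy_fields n \<gamma>))"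
  from span_on_imp_quadratic[OF assms(1) this] quadratic_symmetries[OF _ assms(4)]
  show "X \<in> {X. point_symmetry \<Omega> (gas_eq n \<gamma> S) X \<and> noether_symmetry \<Omega> (lagrangian n \<gamma> S) X}"
    by (metis (no_types, lifting) mem_Collect_eq)
qed

end

section \<open>Comparison of \<open>Z2\<close> with the fields for arbitrary entropy\<close>

lemma Z2_eq_scaling_field:
  "\<gamma> = gamma_star n \<Longrightarrow> Z2 n \<gamma> q = (\<lambda>p. q *\<^sub>R scaling_field p)"
  by (auto simp: gamma_star_iff Z2_def scaling_field_def fun_eq_iff)

text \<open>Every field for arbitrary entropy has zero \<open>s\<close>-component, whereas that of
  \<open>Z2\<close> is the constant that vanishes exactly for the special exponent; one point of
  \<Omega> already decides.\<close>

lemma Z2_in_span_iff: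
  assumes "\<Omega> \<noteq> {}"
  shows "Z2 n \<gamma> q \<in> span_on \<Omega> (arbitrary_entropy_fields n \<gamma>) \<longleftrightarrow> \<gamma> = gamma_star n"
proof
  assume "Z2 n \<gamma> q \<in> span_on \<Omega> (arbitrary_entropy_fields n \<gamma>)"
  then obtain c p where "Z2 n \<gamma> q p = (\<Sum>Y\<in>arbitrary_entropy_fields n \<gamma>. c Y *\<^sub>R Y p)"
    using assms unfolding span_on_def by blast
  then have "fst (snd (Z2 n \<gamma> q p))
      = (\<Sum>Y\<in>arbitrary_entropy_fields n \<gamma>. c Y * fst (snd (Y p)))"
    by (simp add: fst_sum snd_sum)
  also have "\<dots> = 0"
    by (rule sum.neutral)
      (auto simp: arbitrary_entropy_fields_def scaling_field_def split_beta split: if_splits)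
  finally show "\<gamma> = gamma_star n"
    by (simp add: gamma_star_iff Z2_def split_beta)
next
  assume "\<gamma> = gamma_star n"
  moreover from this have "(\<lambda>p. q *\<^sub>R scaling_field p + 0) \<in> span_on \<Omega> (arbitrary_entropy_fields n \<gamma>)"
    by (intro span_on_add_scaled zero_in_span_on finite_arbitrary_entropy_fields)
      (simp add: arbitrary_entropy_fields_def)
  ultimately show "Z2 n \<gamma> q \<in> span_on \<Omega> (arbitrary_entropy_fields n \<gamma>)"
    using Z2_eq_scaling_field by simp
qed

theorem mainTheorem6:
  fixes n :: nat and \<gamma> A0 q :: real and S :: "real \<Rightarrow> real"
  assumes "n \<in> {0, 1, 2}" and "\<gamma> > 1" and "A0 > 0" and "q \<noteq> 0"
    and "S = (\<lambda>s. A0 * exp (q * s))"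
  shows
    "(\<forall>j\<in>jets_over (gas_dom n).
        euler_lagrange (lagrangian n \<gamma> S) j = 0 \<longleftrightarrow> gas_eq n \<gamma> S j = 0)
     \<and> variational_symmetry (gas_dom n) (lagrangian n \<gamma> S) (Z2 n \<gamma> q)
     \<and> (\<forall>j\<in>jets_over (gas_dom n).
          current_t (lagrangian n \<gamma> S) (Z2 n \<gamma> q) j = T2_t n \<gamma> q S j
        \<and> current_s (lagrangian n \<gamma> S) (Z2 n \<gamma> q) j = T2_s n \<gamma> q S j)
     \<and> (\<forall>j\<in>jets_over (gas_dom n). gas_eq n \<gamma> S j = 0 \<longrightarrow>
          Dt (T2_t n \<gamma> q S) j + Ds (T2_s n \<gamma> q S) j = 0)
     \<and> (\<forall>\<Omega>. open \<Omega> \<and> connected \<Omega> \<and> \<Omega> \<noteq> {} \<and> \<Omega> \<subseteq> gas_dom n \<longrightarrow>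
          {X. point_symmetry \<Omega> (gas_eq n \<gamma> S) X \<and> noether_symmetry \<Omega> (lagrangian n \<gamma> S) X}
            = span_on \<Omega> (insert (Z2 n \<gamma> q) (arbitrary_entropy_fields n \<gamma>))
          \<and> (Z2 n \<gamma> q \<in> span_on \<Omega> (arbitrary_entropy_fields n \<gamma>) \<longleftrightarrow> \<gamma> = gamma_star n))
     \<and> (\<gamma> = gamma_star n \<longrightarrow> Z2 n \<gamma> q = (\<lambda>p. q *\<^sub>R scaling_field p))"
proof -
  interpret exponential_gas n \<gamma> A0 q S
    using assms(2-5) by unfold_locales
  show ?thesis
    using euler_lagrange_lagrangian variational_symmetry_Z2 current_Z2 T2_conserved
      noether_point_symmetries Z2_in_span_iff Z2_eq_scaling_field
    by (intro conjI ballI allI impI) auto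
qed

end
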